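(* Let $\boldsymbol\sigma=\{\sigma_i\}_{i=1}^d$ be a shape partition of a nonnegative tensor $\mathcal A\in\mathbb R_+^{N_1\times\cdots\times N_m}$ and let $\mathbf p=(p_1,\ldots,p_d)\in(1,\infty)^d$. Suppose that either $\mathcal A$ is $\boldsymbol\sigma$-strictly nonnegative and $\sum_{i=1}^d|\sigma_i|/p_i<1$, or $\mathcal A$ is $\boldsymbol\sigma$-weakly irreducible and $\sum_{i=1}^d|\sigma_i|/p_i=1$. Then the sequence $\{(\lambda_k,\mathbf x^k)\}$ generated by the algorithm LS-NNM (described in the context) converges to the unique positive $(\boldsymbol\sigma,\mathbf p)$-eigenpair of $\mathcal A$.
   Context: Notation: $[n]=\{1,\ldots,n\}$; $\mathbb R_+$ and $\mathbb R_{++}$ are the nonnegative and positive reals; $\|\cdot\|_p$ is the $\ell_p$-norm; $\circ$ is the entrywise product; inequalities of vectors are entrywise; $D$ denotes the Jacobian. Shape partition: a partition $\boldsymbol\sigma=\{\sigma_i\}_{i=1}^d$ of $[m]$ such that (a) $N_j=N_{j'}$ for all $j,j'\in\sigma_i$ and all $i$; (b) $j\le k$ for all $j\in\sigma_i$, $k\in\sigma_{i+1}$; (c) $|\sigma_i|\le|\sigma_{i+1}|$ for $i\in[d-1]$. Put $\nu_i=|\sigma_i|$, $s_i=\min\sigma_i$, $n_i=N_{s_i}$. Let $\mathbb R^{\boldsymbol\sigma}=\mathbb R^{n_1}\times\cdots\times\mathbb R^{n_d}$, with elements $\mathbf x=(\mathbf x_1,\ldots,\mathbf x_d)$, $\mathbf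 x_i=(x_{i,1},\ldots,x_{i,n_i})$, and $\mathbb R^{\boldsymbol\sigma}_{+}$, $\mathbb R^{\boldsymbol\sigma}_{++}$ the subsets of entrywise nonnegative, resp. positive, elements. For $\mathbf x\in\mathbb R^{\boldsymbol\sigma}$, $\mathbf x^{[\boldsymbol\sigma]}=(\mathbf x_1,\ldots,\mathbf x_1,\ldots,\mathbf x_d,\ldots,\mathbf x_d)$ with $\mathbf x_i$ repeated $\nu_i$ times. For $\mathcal A=(a_{j_1\cdots j_m})$, $i\in[m]$, $j_i\in[N_i]$ and $(\mathbf z_1,\ldots,\mathbf z_m)\in\mathbb R^{N_1}\times\cdots\times\mathbb R^{N_m}$, $\mathscr A_{i,j_i}(\mathbf z_1,\ldots,\mathbf z_m)=\sum_{j_l\in[N_l],\,l\ne i}a_{j_1\cdots j_m}\prod_{l\neq i}z_{l,j_l}$, and $\mathscr A_i=(\mathscr A_{i,1},\ldots,\mathscr A_{i,N_i})$. A pair $(\lambda,\mathbf x)\in\mathbb R\times\mathbb R^{\boldsymbol\sigma}$ is a $(\boldsymbol\sigma,\mathbf p)$-eigenpair of $\mathcal A$ ($\lambda$ an eigenvalue, $\mathbf x$ an eigenvector) if $\mathscr A_{s_i}(\mathbf x^{[\boldsymbol\sigma]})=\lambda\,\psi_{p_i}(\mathbf x_i)$ and $\|\mathbf x_i\|_{p_i}=1$ for all $i\in[d]$, where $\psi_{p}(\mathbf v)$ has entries $|v_j|^{p-1}\mathrm{sign}(v_j)$; it is positive if $\lambda>0$ and $\mathbf x\in\mathbb R^{\boldsymbol\sigma}_{++}$.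 Let $M$ be the square matrix of size $n_1+\cdots+n_d$ with $M_{(i,t_i),(j,l_j)}=\frac{\partial}{\partial x_{j,l_j}}\mathscr A_{s_i,t_i}(\mathbf x^{[\boldsymbol\sigma]})\big|_{\mathbf x=\mathbf 1}$. The nonnegative tensor $\mathcal A$ is $\boldsymbol\sigma$-strictly nonnegative if every row of $M$ has a nonzero entry, and $\boldsymbol\sigma$-weakly irreducible if $M$ is irreducible. By the known Perron–Frobenius theorem of Gautier, Tudisco and Hein, under the hypotheses of the claim $\mathcal A$ has a unique positive $(\boldsymbol\sigma,\mathbf p)$-eigenpair, whose eigenvalue is the spectral radius $r^{(\boldsymbol\sigma,\mathbf p)}(\mathcal A)=\sup\{|\lambda|:\lambda\text{ is a }(\boldsymbol\sigma,\mathbf p)\text{-eigenvalue}\}$. Functions: for $\mathbf x\in\mathbb R^{\boldsymbol\sigma}_{++}$, $\Phi_{i,j_i}(\mathbf x)=\mathscr A_{s_i,j_i}(\mathbf x^{[\boldsymbol\sigma]})/x_{i,j_i}^{p_i-1}$, $\Phi=(\Phi_{i,j_i})$, $\phi(\mathbf x)=\max_{i\in[d],j_i\in[n_i]}\Phi_{i,j_i}(\mathbf x)$; $c(\mathbf x)=\|\mathbf x_1\|_{p_1}\cdots\|\mathbf x_d\|_{p_d}$; $C=\{\mathbf x\in\mathbb R^{\boldsymbol\sigma}_{++}:c(\mathbf x)=1\}$; $R(\mathbf x)=\mathbf x/\sqrt[d]{c(\mathbf x)}$ for $c(\mathbf x)\neq0$; $r(\mathbf x,\lambda)=-\Phi(\mathbf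 x)\circ\mathbf x+\lambda\mathbf x$; $H(\mathbf x,\lambda)=\begin{pmatrix}r(\mathbf x,\lambda)\\ c(\mathbf x)-1\end{pmatrix}$ for $(\mathbf x,\lambda)\in\mathbb R^{\boldsymbol\sigma}_{++}\times\mathbb R_{++}$. Algorithm LS-NNM. Given scalars $\sigma\in(0,1)$, $\rho\in(0,1)$ (the scalar $\sigma$ is unrelated to the partition $\boldsymbol\sigma$) and $\mathbf u^0\in C$, set $\mathbf x^0=R(\mathbf u^0)$, $\lambda_0=\phi(\mathbf x^0)$, $k=0$. While $H(\mathbf x^k,\lambda_k)\ne0$: (1) compute $(\mathbf d^k,\delta_k)\in\mathbb R^{\boldsymbol\sigma}\times\mathbb R$ solving $DH(\mathbf x^k,\lambda_k)\begin{pmatrix}\mathbf d^k\\ \delta_k\end{pmatrix}+H(\mathbf x^k,\lambda_k)=0$; (2) let $\alpha_k$ be the largest element of $\{\rho^i:i=0,1,\ldots\}$ with $\mathbf x^k+\alpha_k\mathbf d^k>0$ and $\phi(R(\mathbf x^k+\alpha_k\mathbf d^k))\le\phi(\mathbf x^k)+\sigma\alpha_k\delta_k$; (3) set $\mathbf x^{k+1}=R(\mathbf x^k+\alpha_k\mathbf d^k)$, $\lambda_{k+1}=\phi(\mathbf x^{k+1})$, $k\leftarrow k+1$. If the algorithm stops at some $k$ (i.e. $H(\mathbf x^k,\lambda_k)=0$), the sequences are understood to be continued by $\mathbf x^j=\mathbf x^k$, $\lambda_j=\lambda_k$, $\mathbf d^j=0$, $\delta_j=0$, $\alpha_j=1$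 for the remaining indices $j\ge k$. *)

theory Defs
  imports "HOL-Analysis.Analysis" "HOL-Library.Disjoint_Sets"
begin

text \<open>
  All index sets are 1-based, \<open>[n] = {1..n}\<close>.  An order-\<open>m\<close> tensor of dimensions
  \<open>N 1, ..., N m\<close> is a function \<open>A\<close> on multi-indices \<open>J\<close> in \<open>multi_index m N\<close>, with
  \<open>A J\<close> the entry \<open>a_{J 1, ..., J m}\<close>; values outside that set are never used.
\<close>

definition multi_index :: "nat \<Rightarrow> (nat \<Rightarrow> nat) \<Rightarrow> (nat \<Rightarrow> nat) set" where
  "multi_index m N = (\<Pi>\<^sub>E l\<in>{1..m}. {1..N l})"

definition nonneg_tensor :: "nat \<Rightarrow> (nat \<Rightarrow> nat) \<Rightarrow> ((nat \<Rightarrow> nat) \<Rightarrow> real) \<Rightarrow> bool" where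
  "nonneg_tensor m N A \<longleftrightarrow>
     1 \<le> m \<and> (\<forall>l\<in>{1..m}. 1 \<le> N l) \<and> (\<forall>J\<in>multi_index m N. 0 \<le> A J)"

definition shape_partition :: "nat \<Rightarrow> (nat \<Rightarrow> nat) \<Rightarrow> nat \<Rightarrow> (nat \<Rightarrow> nat set) \<Rightarrow> bool" where
  "shape_partition m N d \<sigma> \<longleftrightarrow>
     partition_on {1..m} (\<sigma> ` {1..d}) \<and> inj_on \<sigma> {1..d} \<and>
     (\<forall>i\<in>{1..d}. \<forall>j\<in>\<sigma> i. \<forall>j'\<in>\<sigma> i. N j = N j') \<and>
     (\<forall>i\<in>{1..d-1}. \<forall>j\<in>\<sigma> i. \<forall>k\<in>\<sigma> (i+1). j \<le> k) \<and>
     (\<forall>i\<in>{1..d-1}. card (\<sigma> i) \<le> card (\<sigma> (i+1)))"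

definition lp_norm :: "nat \<Rightarrow> real \<Rightarrow> (nat \<Rightarrow> real) \<Rightarrow> real" where
  "lp_norm n q v = (\<Sum>j\<in>{1..n}. \<bar>v j\<bar> powr q) powr (1 / q)"

definition psi :: "real \<Rightarrow> real \<Rightarrow> real" where
  "psi q t = \<bar>t\<bar> powr (q - 1) * sgn t"

text \<open>
  The locale carries no assumptions; it only fixes the data on which the notions depend.
\<close>

locale tensor_data =
  fixes m :: nat and N :: "nat \<Rightarrow> nat" and A :: "(nat \<Rightarrow> nat) \<Rightarrow> real"
    and d :: nat and \<sigma> :: "nat \<Rightarrow> nat set" and p :: "nat \<Rightarrow> real"
begin

definition s :: "nat \<Rightarrow> nat" where
  "s i = Min (\<sigma> i)"

definition n :: "nat \<Rightarrow> nat" where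
  "n i = N (s i)"

definition idx :: "(nat \<times> nat) set" where
  "idx = (SIGMA i:{1..d}. {1..n i})"

text \<open>
  An element of \<open>R^\<sigma> = R^(n 1) \<times> ... \<times> R^(n d)\<close> is encoded as a doubly indexed family that is zero
  outside \<open>idx\<close>, so that HOL equality is equality in \<open>R^\<sigma>\<close>.
\<close>

definition Rsigma :: "(nat \<Rightarrow> nat \<Rightarrow> real) set" where
  "Rsigma = {x. \<forall>i j. (i, j) \<notin> idx \<longrightarrow> x i j = 0}"

definition Rsigma_pos :: "(nat \<Rightarrow> nat \<Rightarrow> real) set" where
  "Rsigma_pos = {x \<in> Rsigma. \<forall>(i, j)\<in>idx. 0 < x i j}"

text \<open>
  Since the blocks \<open>\<sigma> 1, \<sigma> 2, ...\<close> are consecutive in \<open>[m]\<close>, the list in which \<open>x i\<close> is repeated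
  \<open>|\<sigma> i|\<close> times has \<open>x i\<close> exactly at the positions \<open>l \<in> \<sigma> i\<close>.
\<close>

definition rep :: "(nat \<Rightarrow> nat \<Rightarrow> real) \<Rightarrow> nat \<Rightarrow> nat \<Rightarrow> real" where
  "rep x l = x (THE i. i \<in> {1..d} \<and> l \<in> \<sigma> i)"

definition scrA :: "nat \<Rightarrow> nat \<Rightarrow> (nat \<Rightarrow> nat \<Rightarrow> real) \<Rightarrow> real" where
  "scrA i t z = (\<Sum>J | J \<in> multi_index m N \<and> J i = t. A J * (\<Prod>l\<in>{1..m} - {i}. z l (J l)))"

definition eigenpair :: "real \<Rightarrow> (nat \<Rightarrow> nat \<Rightarrow> real) \<Rightarrow> bool" where
  "eigenpair lam x \<longleftrightarrow> x \<in> Rsigma \<and>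
     (\<forall>i\<in>{1..d}. (\<forall>t\<in>{1..n i}. scrA (s i) t (rep x) = lam * psi (p i) (x i t)) \<and>
                 lp_norm (n i) (p i) (x i) = 1)"

definition positive_eigenpair :: "real \<Rightarrow> (nat \<Rightarrow> nat \<Rightarrow> real) \<Rightarrow> bool" where
  "positive_eigenpair lam x \<longleftrightarrow> eigenpair lam x \<and> 0 < lam \<and> x \<in> Rsigma_pos"

text \<open>\<open>upd x (k, l) u\<close> replaces the coordinate \<open>x k l\<close> by \<open>u\<close>; it serves to form partial derivatives.\<close>

definition upd :: "(nat \<Rightarrow> nat \<Rightarrow> real) \<Rightarrow> nat \<times> nat \<Rightarrow> real \<Rightarrow> nat \<Rightarrow> nat \<Rightarrow> real" where
  "upd x b u = x(fst b := (x (fst b))(snd b := u))"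

definition M :: "nat \<times> nat \<Rightarrow> nat \<times> nat \<Rightarrow> real" where
  "M a b = deriv (\<lambda>u. scrA (s (fst a)) (snd a) (rep (upd (\<lambda>_ _. 1) b u))) 1"

definition strictly_nonnegative :: bool where
  "strictly_nonnegative \<longleftrightarrow> (\<forall>a\<in>idx. \<exists>b\<in>idx. M a b \<noteq> 0)"

text \<open>
  Irreducibility of the nonnegative matrix \<open>M\<close>: its digraph is strongly connected by walks of
  positive length, i.e. for all \<open>a, b\<close> some power \<open>M^k\<close>, \<open>k \<ge> 1\<close>, has a positive \<open>(a, b)\<close> entry.
  The restriction to positive length only matters for the \<open>1 \<times> 1\<close> zero matrix, which is thereby
  not irreducible (the zero tensor has no positive eigenpair).
\<close>

definition weakly_irreducible :: bool where
  "weakly_irreducible \<longleftrightarrow>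
     (\<forall>a\<in>idx. \<forall>b\<in>idx. (a, b) \<in> {(a, b). a \<in> idx \<and> b \<in> idx \<and> M a b \<noteq> 0}\<^sup>+)"

definition Phi :: "(nat \<Rightarrow> nat \<Rightarrow> real) \<Rightarrow> nat \<Rightarrow> nat \<Rightarrow> real" where
  "Phi x i j = scrA (s i) j (rep x) / x i j powr (p i - 1)"

definition phi :: "(nat \<Rightarrow> nat \<Rightarrow> real) \<Rightarrow> real" where
  "phi x = Max ((\<lambda>(i, j). Phi x i j) ` idx)"

definition c :: "(nat \<Rightarrow> nat \<Rightarrow> real) \<Rightarrow> real" where
  "c x = (\<Prod>i\<in>{1..d}. lp_norm (n i) (p i) (x i))"

definition C :: "(nat \<Rightarrow> nat \<Rightarrow> real) set" where
  "C = {x \<in> Rsigma_pos. c x = 1}"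

definition R :: "(nat \<Rightarrow> nat \<Rightarrow> real) \<Rightarrow> nat \<Rightarrow> nat \<Rightarrow> real" where
  "R x = (\<lambda>i j. x i j / root d (c x))"

definition r :: "(nat \<Rightarrow> nat \<Rightarrow> real) \<Rightarrow> real \<Rightarrow> nat \<Rightarrow> nat \<Rightarrow> real" where
  "r x lam i j = - Phi x i j * x i j + lam * x i j"

text \<open>
  Vectors in \<open>R^\<sigma> \<times> R\<close>, and the rows and columns of the Jacobian \<open>DH\<close>, are indexed by \<open>idx1\<close>:
  \<open>Some (i, j)\<close> stands for the \<open>(i, j)\<close> coordinate in \<open>R^\<sigma>\<close> and \<open>None\<close> for the last one.
\<close>

definition idx1 :: "(nat \<times> nat) option set" where
  "idx1 = insert None (Some ` idx)"

definition H :: "(nat \<Rightarrow> nat \<Rightarrow> real) \<Rightarrow> real \<Rightarrow> (nat \<times> nat) option \<Rightarrow> real" where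
  "H x lam a = (case a of Some (i, j) \<Rightarrow> r x lam i j | None \<Rightarrow> c x - 1)"

definition DH :: "(nat \<Rightarrow> nat \<Rightarrow> real) \<Rightarrow> real \<Rightarrow> (nat \<times> nat) option \<Rightarrow> (nat \<times> nat) option \<Rightarrow> real" where
  "DH x lam a b =
     (case b of Some (k, l) \<Rightarrow> deriv (\<lambda>u. H (upd x (k, l) u) lam a) (x k l)
              | None \<Rightarrow> deriv (\<lambda>u. H x u a) lam)"

definition newton_step ::
  "(nat \<Rightarrow> nat \<Rightarrow> real) \<Rightarrow> real \<Rightarrow> (nat \<Rightarrow> nat \<Rightarrow> real) \<Rightarrow> real \<Rightarrow> bool" where
  "newton_step x lam dir del \<longleftrightarrow> dir \<in> Rsigma \<and>
     (\<forall>a\<in>idx1. (\<Sum>b\<in>idx1. DH x lam a b * (case b of Some (k, l) \<Rightarrow> dir k l | None \<Rightarrow> del))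
                 + H x lam a = 0)"

definition move :: "(nat \<Rightarrow> nat \<Rightarrow> real) \<Rightarrow> real \<Rightarrow> (nat \<Rightarrow> nat \<Rightarrow> real) \<Rightarrow> nat \<Rightarrow> nat \<Rightarrow> real" where
  "move x al dir = (\<lambda>i j. x i j + al * dir i j)"

definition admissible_steps ::
  "real \<Rightarrow> real \<Rightarrow> (nat \<Rightarrow> nat \<Rightarrow> real) \<Rightarrow> (nat \<Rightarrow> nat \<Rightarrow> real) \<Rightarrow> real \<Rightarrow> real set" where
  "admissible_steps sg rho x dir del =
     {al \<in> range (\<lambda>i::nat. rho ^ i).
        move x al dir \<in> Rsigma_pos \<and> phi (R (move x al dir)) \<le> phi x + sg * al * del}"

text \<open>
  \<open>LS_NNM sg rho u0 x lam dir del al\<close>: the five sequences form a run of the algorithm with scalar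
  parameters \<open>sg, rho\<close> and starting point \<open>u0\<close>, continued constantly after termination.
\<close>

definition LS_NNM ::
  "real \<Rightarrow> real \<Rightarrow> (nat \<Rightarrow> nat \<Rightarrow> real) \<Rightarrow> (nat \<Rightarrow> nat \<Rightarrow> nat \<Rightarrow> real) \<Rightarrow> (nat \<Rightarrow> real) \<Rightarrow>
   (nat \<Rightarrow> nat \<Rightarrow> nat \<Rightarrow> real) \<Rightarrow> (nat \<Rightarrow> real) \<Rightarrow> (nat \<Rightarrow> real) \<Rightarrow> bool" where
  "LS_NNM sg rho u0 x lam dir del al \<longleftrightarrow>
     x 0 = R u0 \<and> lam 0 = phi (x 0) \<and>
     (\<forall>k. if \<forall>a\<in>idx1. H (x k) (lam k) a = 0
          then x (Suc k) = x k \<and> lam (Suc k) = lam k \<and>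
               dir k = (\<lambda>_ _. 0) \<and> del k = 0 \<and> al k = 1
          else newton_step (x k) (lam k) (dir k) (del k) \<and>
               al k \<in> admissible_steps sg rho (x k) (dir k) (del k) \<and>
               (\<forall>\<beta>\<in>admissible_steps sg rho (x k) (dir k) (del k). \<beta> \<le> al k) \<and>
               x (Suc k) = R (move (x k) (al k) (dir k)) \<and>
               lam (Suc k) = phi (x (Suc k)))"

end

end

theory Submission
  imports Defs
begin

text \<open>
  Write a positive point as \<open>x = exp y\<close> and a direction as \<open>d = x v\<close>, so that \<open>v\<close> is a velocity of \<open>y\<close>.
  In these coordinates \<open>Phi a\<close> has the logarithmic derivative \<open>P v a - (p a - 1) v a\<close>, where the matrix \<open>P\<close> is
  nonnegative, and the weights \<open>z a = 1 / p a\<close> satisfy \<open>P z a - (p a - 1) z a = S - 1 \<le> 0\<close> with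
  \<open>S = (\<Sum>i. |\<sigma> i| / p i)\<close>.  Hence minus the derivative of \<open>ln Phi\<close> is an M-matrix, strictly dominant along
  \<open>z\<close> if \<open>S < 1\<close> and singular but irreducible if \<open>S = 1\<close>.  Divided by \<open>x a\<close>, the Newton equations at
  \<open>\<lambda> = phi x\<close> read \<open>(phi x - Phi a) (v a + 1) + \<delta> = dPhi a v\<close>, together with tangency of \<open>v\<close> to
  the normalisation \<open>c = 1\<close>.  Everything rests on the resulting maximum principle \<open>max_principle\<close>: a
  tangent \<open>v\<close> with \<open>dPhi a v \<ge> (phi x - Phi a) v a\<close> for all \<open>a\<close> vanishes.
  
  It gives solvability of the Newton system (\<open>newton_matrix_injective\<close>) and \<open>\<delta> < 0\<close> unless \<open>Phi\<close> is
  constant at \<open>x\<close> (\<open>newton_decrease_nonneg\<close>).  Along the step, the derivative of a component with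
  \<open>Phi a = phi x\<close> is exactly \<open>\<delta>\<close>, so the line search succeeds, and does so uniformly near a point where the
  limiting \<open>\<delta>\<close> is negative (\<open>line_search_eventually_adm\<close>).  The values \<open>phi\<close> decrease, and on the set
  \<open>c = 1\<close> the sublevel sets of \<open>phi\<close> stay away from \<open>0\<close> and from infinity (\<open>sublevel_bounds\<close>); this
  uses the contraction factor \<open>S - 1\<close> or, when it degenerates, connectedness.  Thus the products \<open>\<alpha> \<delta>\<close> tend to
  \<open>0\<close>, the Newton directions remain bounded (\<open>newton_bounded\<close>), and at a cluster point \<open>\<delta>\<close> must be
  \<open>0\<close>, since otherwise the step lengths would tend to \<open>0\<close> although larger ones are admissible.  So each
  cluster point has constant \<open>Phi\<close> (\<open>run_cluster_point\<close>).
  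
  There is at most one such point, by the finite version of the maximum principle
  (\<open>constant_Ph_compare\<close>), and it is the positive eigenvector (\<open>solution_positive_eigenpair\<close>).  Therefore
  the whole sequence converges; the existence of an eigenpair is obtained from the algorithm itself, as the limit
  of a run.
\<close>

section \<open>Square linear systems\<close>

text \<open>
  Gaussian elimination: an equation with a nonzero coefficient removes one unknown and itself.
\<close>

lemma underdetermined_system_nontrivial:
  fixes Mx :: "'e \<Rightarrow> 'u \<Rightarrow> 'f::field"
  assumes "finite E" "finite U" "card E < card U"
  shows "\<exists>y. (\<exists>u\<in>U. y u \<noteq> 0) \<and> (\<forall>i\<in>E. (\<Sum>u\<in>U. Mx i u * y u) = 0)"
  using assms
proof (induction E arbitrary: U Mx rule: finite_induct)
  case empty
  then obtain u where "u \<in> U" by fastforce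
  then show ?case by (intro exI[of _ "\<lambda>_. 1"]) auto
next
  case (insert i E)
  show ?case
  proof (cases "\<forall>u\<in>U. Mx i u = 0")
    case True
    have "card E < card U" using insert by simp
    from insert.IH[OF insert.prems(1) this, of Mx] obtain y where
      "\<exists>u\<in>U. y u \<noteq> 0" "\<forall>i\<in>E. (\<Sum>u\<in>U. Mx i u * y u) = 0" by blast
    with True show ?thesis by (intro exI[of _ y]) auto
  next
    case False
    then obtain u0 where u0: "u0 \<in> U" "Mx i u0 \<noteq> 0" by blast
    define U' where "U' = U - {u0}"
    have U: "U = insert u0 U'" "u0 \<notin> U'" "finite U'"
      using u0 insert.prems by (auto simp: U'_def)
    have "card E < card U'" using insert.prems insert.hyps U by simp
    from insert.IH[OF U(3) this, of "\<lambda>j u. Mx j u - Mx j u0 * Mx i u / Mx i u0"]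
    obtain y where y: "\<exists>u\<in>U'. y u \<noteq> 0"
      and y0: "\<forall>j\<in>E. (\<Sum>u\<in>U'. (Mx j u - Mx j u0 * Mx i u / Mx i u0) * y u) = 0" by blast
    define y' where "y' = y(u0 := - (\<Sum>u\<in>U'. Mx i u * y u) / Mx i u0)"
    have same: "(\<Sum>u\<in>U'. Mx j u * y' u) = (\<Sum>u\<in>U'. Mx j u * y u)" for j
      using U(2) by (intro sum.cong) (auto simp: y'_def)
    have full: "(\<Sum>u\<in>U. Mx j u * y' u)
        = (\<Sum>u\<in>U'. Mx j u * y u) - Mx j u0 / Mx i u0 * (\<Sum>u\<in>U'. Mx i u * y u)" for j
      using U(2,3) same unfolding U(1) by (simp add: y'_def)
    have "(\<Sum>u\<in>U. Mx j u * y' u) = 0" if "j \<in> insert i E" for j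
    proof (cases "j = i")
      case True
      then show ?thesis using full[of i] u0 by simp
    next
      case False
      then have "(\<Sum>u\<in>U'. (Mx j u - Mx j u0 * Mx i u / Mx i u0) * y u) = 0"
        using that y0 by blast
      also have "(\<Sum>u\<in>U'. (Mx j u - Mx j u0 * Mx i u / Mx i u0) * y u)
          = (\<Sum>u\<in>U'. Mx j u * y u - Mx j u0 / Mx i u0 * (Mx i u * y u))"
        by (intro sum.cong refl) (simp add: left_diff_distrib)
      finally show ?thesis
        unfolding full by (simp add: sum_subtractf sum_distrib_left)
    qed
    moreover have "\<exists>u\<in>U. y' u \<noteq> 0" using y U by (auto simp: y'_def)
    ultimately show ?thesis by blast
  qed
qed

text \<open>
  With the right hand side as one more unknown the system becomes underdetermined; injectivity
  forbids a nontrivial solution in which the new unknown vanishes.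
\<close>

lemma injective_square_system_solvable:
  fixes Mx :: "'u \<Rightarrow> 'u \<Rightarrow> 'f::field"
  assumes fin: "finite U"
    and inj: "\<And>y. (\<And>i. i \<in> U \<Longrightarrow> (\<Sum>u\<in>U. Mx i u * y u) = 0) \<Longrightarrow> \<forall>u\<in>U. y u = 0"
  shows "\<exists>y. \<forall>i\<in>U. (\<Sum>u\<in>U. Mx i u * y u) + b i = 0"
proof -
  define V where "V = insert None (Some ` U)"
  have V: "finite V" "card U < card V"
    using fin by (auto simp: V_def card_image)
  from underdetermined_system_nontrivial[OF fin V, of "\<lambda>i. case_option (b i) (Mx i)"]
  obtain y where y: "\<exists>u\<in>V. y u \<noteq> 0"
    and y0: "\<And>i. i \<in> U \<Longrightarrow> (\<Sum>u\<in>V. case_option (b i) (Mx i) u * y u) = 0" by blast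
  have eq: "(\<Sum>u\<in>U. Mx i u * y (Some u)) + b i * y None = 0" if "i \<in> U" for i
    using y0[OF that] fin by (simp add: V_def sum.reindex add.commute)
  have nz: "y None \<noteq> 0"
  proof
    assume "y None = 0"
    then have "\<forall>u\<in>U. y (Some u) = 0" using eq by (intro inj) simp
    with y \<open>y None = 0\<close> show False by (auto simp: V_def)
  qed
  have "(\<Sum>u\<in>U. Mx i u * (y (Some u) / y None)) + b i = 0" if "i \<in> U" for i
  proof -
    have "(\<Sum>u\<in>U. Mx i u * (y (Some u) / y None)) + b i
        = ((\<Sum>u\<in>U. Mx i u * y (Some u)) + b i * y None) / y None"
      using nz by (simp add: sum_divide_distrib add_divide_distrib)
    then show ?thesis using eq[OF that] by simp
  qed
  then show ?thesis by (intro exI[of _ "\<lambda>u. y (Some u) / y None"] ballI)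
qed

section \<open>Limits and products of finite families\<close>

lemma bounded_family_convergent_subseq:
  fixes X :: "nat \<Rightarrow> 'a \<Rightarrow> real"
  assumes "finite I" "\<And>k a. a \<in> I \<Longrightarrow> \<bar>X k a\<bar> \<le> B"
  shows "\<exists>f x. strict_mono (f :: nat \<Rightarrow> nat) \<and> (\<forall>a\<in>I. (\<lambda>k. X (f k) a) \<longlonglongrightarrow> x a)"
  using assms
proof (induction I rule: finite_induct)
  case empty
  show ?case by (intro exI[of _ id]) (auto simp: strict_mono_def)
next
  case (insert i I)
  then obtain f x where f: "strict_mono (f :: nat \<Rightarrow> nat)"
    and x: "\<forall>a\<in>I. (\<lambda>k. X (f k) a) \<longlonglongrightarrow> x a" by auto
  have "bounded (range (\<lambda>k. X (f k) i))"
    using insert.prems by (auto simp: bounded_iff)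
  from bounded_imp_convergent_subsequence[OF this] obtain l g where
    g: "strict_mono g" "((\<lambda>k. X (f k) i) \<circ> g) \<longlonglongrightarrow> l" by blast
  have "(\<lambda>k. X ((f \<circ> g) k) a) \<longlonglongrightarrow> (x(i := l)) a" if "a \<in> insert i I" for a
  proof (cases "a = i")
    case True
    then show ?thesis using g by (simp add: o_def)
  next
    case False
    then have "((\<lambda>k. X (f k) a) \<circ> g) \<longlonglongrightarrow> x a"
      using x that g by (intro LIMSEQ_subseq_LIMSEQ) auto
    then show ?thesis using False by (simp add: o_def)
  qed
  then show ?case
    using strict_mono_o[OF f g(1)] by (intro exI[of _ "f \<circ> g"] exI[of _ "x(i := l)"]) blast
qed

lemma tendsto_Max_image:
  fixes f :: "'b \<Rightarrow> 'a \<Rightarrow> real"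
  assumes "finite I" "I \<noteq> {}" "\<And>a. a \<in> I \<Longrightarrow> ((\<lambda>k. f k a) \<longlongrightarrow> g a) net"
  shows "((\<lambda>k. Max (f k ` I)) \<longlongrightarrow> Max (g ` I)) net"
  using assms
proof (induction I rule: finite_ne_induct)
  case (insert a I)
  then show ?case by (simp add: tendsto_max)
qed simp

lemma tendsto_if_subsubseq:
  fixes X :: "nat \<Rightarrow> real"
  assumes "\<And>f. strict_mono (f :: nat \<Rightarrow> nat) \<Longrightarrow>
    \<exists>g. strict_mono (g :: nat \<Rightarrow> nat) \<and> (\<lambda>k. X (f (g k))) \<longlonglongrightarrow> l"
  shows "X \<longlonglongrightarrow> l"
proof (rule ccontr)
  assume "\<not> X \<longlonglongrightarrow> l"
  then obtain \<epsilon> where \<epsilon>: "\<epsilon> > 0" "\<forall>n0. \<exists>k\<ge>n0. \<not> dist (X k) l < \<epsilon>"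
    unfolding lim_sequentially by blast
  then have "infinite {k. \<not> dist (X k) l < \<epsilon>}"
    unfolding infinite_nat_iff_unbounded_le by blast
  from infinite_enumerate[OF this] obtain f where
    f: "strict_mono (f :: nat \<Rightarrow> nat)" "\<And>k. \<not> dist (X (f k)) l < \<epsilon>" by blast
  from assms[OF f(1)] obtain g where "(\<lambda>k. X (f (g k))) \<longlonglongrightarrow> l" by blast
  then obtain k where "dist (X (f (g k))) l < \<epsilon>"
    using \<epsilon>(1) unfolding lim_sequentially by blast
  with f(2) show False by blast
qed

lemma prod_strict_mono_ex1:
  fixes f g :: "'a \<Rightarrow> real"
  assumes "finite A" "\<And>i. i \<in> A \<Longrightarrow> 0 < f i \<and> f i \<le> g i" "j \<in> A" "f j < g j"
  shows "prod f A < prod g A"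
proof -
  have "prod f A = f j * prod f (A - {j})" "prod g A = g j * prod g (A - {j})"
    using assms by (simp_all add: prod.remove)
  moreover have "prod f (A - {j}) \<le> prod g (A - {j})" "0 < prod f (A - {j})"
    using assms(2) by (auto intro!: prod_mono prod_pos simp: less_imp_le)
  moreover have "0 < f j" using assms by blast
  ultimately show ?thesis
    using assms(4) by (simp add: mult_less_le_imp_less)
qed

section \<open>Posynomial systems with balanced weights\<close>

text \<open>
  An index \<open>a \<in> I\<close> stands for a coordinate of the point \<open>x\<close> and also for a row of the system.  Row \<open>a\<close> is the
  posynomial with terms \<open>\<tau> \<in> T a\<close>, coefficients \<open>K \<tau>\<close> and variables \<open>e \<tau> l\<close>, \<open>l \<in> L a\<close>.
  Coordinates are grouped into blocks by \<open>blk\<close>, and \<open>q\<close> assigns to each block its norm exponent.  The balance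
  condition is all that remains of the multihomogeneity of a tensor: the variables of each term in row \<open>a\<close> have
  total weight \<open>S - 1 / q (blk a)\<close>.  If \<open>S < 1\<close> the system contracts in the weighted scaling; for \<open>S = 1\<close>
  connectedness of the variable graph takes the place of the contraction.  The functions \<open>Ph\<close>, \<open>ph\<close>, \<open>cc\<close>
  and \<open>rn\<close> below are the abstract forms of \<open>Phi\<close>, \<open>phi\<close>, \<open>c\<close> and \<open>R\<close>.
\<close>

locale posynomial_system =
  fixes I :: "'a set" and T :: "'a \<Rightarrow> 't set" and K :: "'t \<Rightarrow> real"
    and L :: "'a \<Rightarrow> 'l set" and e :: "'t \<Rightarrow> 'l \<Rightarrow> 'a"
    and blk :: "'a \<Rightarrow> 'k" and q :: "'k \<Rightarrow> real" and S :: real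
  assumes finite_I: "finite I" and I_nonempty: "I \<noteq> {}"
    and finite_T: "a \<in> I \<Longrightarrow> finite (T a)" and finite_L: "a \<in> I \<Longrightarrow> finite (L a)"
    and K_nonneg: "a \<in> I \<Longrightarrow> \<tau> \<in> T a \<Longrightarrow> 0 \<le> K \<tau>"
    and e_in_I: "a \<in> I \<Longrightarrow> \<tau> \<in> T a \<Longrightarrow> l \<in> L a \<Longrightarrow> e \<tau> l \<in> I"
    and q_gt_1: "a \<in> I \<Longrightarrow> 1 < q (blk a)"
    and balanced: "a \<in> I \<Longrightarrow> \<tau> \<in> T a \<Longrightarrow>
      (\<Sum>l\<in>L a. 1 / q (blk (e \<tau> l))) = S - 1 / q (blk a)"
    and S_le_1: "S \<le> 1"
    and row_nonzero: "a \<in> I \<Longrightarrow> \<exists>\<tau>\<in>T a. 0 < K \<tau>"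
    and strongly_connected: "S = 1 \<Longrightarrow> a \<in> I \<Longrightarrow> b \<in> I \<Longrightarrow>
      (a, b) \<in> {(a, b). a \<in> I \<and> (\<exists>\<tau>\<in>T a. 0 < K \<tau> \<and> b \<in> e \<tau> ` L a)}\<^sup>+"
begin

abbreviation p :: "'a \<Rightarrow> real" where "p a \<equiv> q (blk a)"

definition z :: "'a \<Rightarrow> real" where "z a = 1 / p a"

definition edges :: "('a \<times> 'a) set" where
  "edges = {(a, b). a \<in> I \<and> (\<exists>\<tau>\<in>T a. 0 < K \<tau> \<and> b \<in> e \<tau> ` L a)}"

definition pos :: "('a \<Rightarrow> real) \<Rightarrow> bool" where "pos x \<longleftrightarrow> (\<forall>a\<in>I. 0 < x a)"

definition mon :: "'a \<Rightarrow> 't \<Rightarrow> ('a \<Rightarrow> real) \<Rightarrow> real" where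
  "mon a \<tau> x = (\<Prod>l\<in>L a. x (e \<tau> l))"

definition F :: "'a \<Rightarrow> ('a \<Rightarrow> real) \<Rightarrow> real" where
  "F a x = (\<Sum>\<tau>\<in>T a. K \<tau> * mon a \<tau> x)"

text \<open>
  The derivative of \<open>F a\<close> along a curve through \<open>x\<close> whose logarithm has velocity \<open>v\<close>; likewise for
  \<open>Ph a\<close> and \<open>dPh\<close>.
\<close>

definition dF :: "'a \<Rightarrow> ('a \<Rightarrow> real) \<Rightarrow> ('a \<Rightarrow> real) \<Rightarrow> real" where
  "dF a x v = (\<Sum>\<tau>\<in>T a. K \<tau> * mon a \<tau> x * (\<Sum>l\<in>L a. v (e \<tau> l)))"

definition Ph :: "'a \<Rightarrow> ('a \<Rightarrow> real) \<Rightarrow> real" where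
  "Ph a x = F a x / x a powr (p a - 1)"

definition dPh :: "'a \<Rightarrow> ('a \<Rightarrow> real) \<Rightarrow> ('a \<Rightarrow> real) \<Rightarrow> real" where
  "dPh a x v = Ph a x * (dF a x v / F a x - (p a - 1) * v a)"

definition ph :: "('a \<Rightarrow> real) \<Rightarrow> real" where
  "ph x = Max ((\<lambda>a. Ph a x) ` I)"

definition block :: "'k \<Rightarrow> 'a set" where "block k = {a \<in> I. blk a = k}"

definition nrm :: "'k \<Rightarrow> ('a \<Rightarrow> real) \<Rightarrow> real" where
  "nrm k x = (\<Sum>a\<in>block k. \<bar>x a\<bar> powr q k) powr (1 / q k)"

definition cc :: "('a \<Rightarrow> real) \<Rightarrow> real" where
  "cc x = (\<Prod>k\<in>blk ` I. nrm k x)"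

text \<open>
  The gradient of \<open>ln cc\<close> in logarithmic coordinates; \<open>W x v = 0\<close> is tangency to \<open>cc = 1\<close>.
\<close>

definition w :: "('a \<Rightarrow> real) \<Rightarrow> 'a \<Rightarrow> real" where
  "w x a = x a powr p a / (\<Sum>b\<in>block (blk a). x b powr p b)"

definition W :: "('a \<Rightarrow> real) \<Rightarrow> ('a \<Rightarrow> real) \<Rightarrow> real" where
  "W x v = (\<Sum>a\<in>I. w x a * v a)"

definition rn :: "('a \<Rightarrow> real) \<Rightarrow> 'a \<Rightarrow> real" where
  "rn x = (\<lambda>a. x a / root (card (blk ` I)) (cc x))"

lemma p_gt_0: "a \<in> I \<Longrightarrow> 0 < p a"
  using q_gt_1 by force

lemma z_pos: "a \<in> I \<Longrightarrow> 0 < z a"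
  using p_gt_0 by (simp add: z_def)

lemma z_less_1: "a \<in> I \<Longrightarrow> z a < 1"
  using q_gt_1[of a] by (simp add: z_def)

lemma p_times_z: "a \<in> I \<Longrightarrow> p a * z a = 1"
  using p_gt_0[of a] by (simp add: z_def)

lemma sum_z: "a \<in> I \<Longrightarrow> \<tau> \<in> T a \<Longrightarrow> (\<Sum>l\<in>L a. z (e \<tau> l)) = S - z a"
  using balanced by (simp add: z_def)

lemma posD: "pos x \<Longrightarrow> a \<in> I \<Longrightarrow> 0 < x a"
  by (simp add: pos_def)

lemma mon_pos: "pos x \<Longrightarrow> a \<in> I \<Longrightarrow> \<tau> \<in> T a \<Longrightarrow> 0 < mon a \<tau> x"
  unfolding mon_def pos_def using e_in_I by (intro prod_pos) blast

lemma F_pos: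
  assumes "pos x" "a \<in> I"
  shows "0 < F a x"
proof -
  obtain \<tau> where "\<tau> \<in> T a" "0 < K \<tau>" using row_nonzero[OF assms(2)] by blast
  then show ?thesis
    unfolding F_def using assms mon_pos mult_nonneg_nonneg[OF K_nonneg less_imp_le[OF mon_pos]]
    by (intro sum_pos2[OF finite_T[OF assms(2)], of \<tau>]) auto
qed

lemma Ph_pos: "pos x \<Longrightarrow> a \<in> I \<Longrightarrow> 0 < Ph a x"
  using F_pos[of x a] posD[of x a] by (simp add: Ph_def)

lemma Ph_le_ph: "a \<in> I \<Longrightarrow> Ph a x \<le> ph x"
  unfolding ph_def using finite_I by (intro Max_ge) auto

lemma ph_le: "(\<And>a. a \<in> I \<Longrightarrow> Ph a x \<le> y) \<Longrightarrow> ph x \<le> y"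
  unfolding ph_def using finite_I I_nonempty by (subst Max_le_iff) auto

lemma ph_pos: "pos x \<Longrightarrow> 0 < ph x"
  using I_nonempty Ph_pos Ph_le_ph by (meson all_not_in_conv less_le_trans)

lemma pos_cong: "(\<And>a. a \<in> I \<Longrightarrow> x a = y a) \<Longrightarrow> pos x = pos y"
  by (simp add: pos_def)

lemma F_cong: "(\<And>a. a \<in> I \<Longrightarrow> x a = y a) \<Longrightarrow> a \<in> I \<Longrightarrow> F a x = F a y"
  unfolding F_def mon_def using e_in_I by (intro sum.cong arg_cong2[of _ _ _ _ "(*)"] prod.cong) auto

lemma Ph_cong: "(\<And>a. a \<in> I \<Longrightarrow> x a = y a) \<Longrightarrow> a \<in> I \<Longrightarrow> Ph a x = Ph a y"
  using F_cong[of x y a] by (simp add: Ph_def)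

lemma ph_cong: "(\<And>a. a \<in> I \<Longrightarrow> x a = y a) \<Longrightarrow> ph x = ph y"
  unfolding ph_def using Ph_cong[of x y] by (intro arg_cong[of _ _ Max] image_cong) auto

lemma cc_cong: "(\<And>a. a \<in> I \<Longrightarrow> x a = y a) \<Longrightarrow> cc x = cc y"
  unfolding cc_def nrm_def block_def by (intro prod.cong arg_cong2[of _ _ _ _ "(powr)"] sum.cong) auto

lemma mon_scale:
  assumes "a \<in> I" "\<tau> \<in> T a"
  shows "mon a \<tau> (\<lambda>b. exp (\<theta> * z b) * y b) = exp (\<theta> * (S - z a)) * mon a \<tau> y"
proof -
  have "(\<Prod>l\<in>L a. exp (\<theta> * z (e \<tau> l))) = exp (\<theta> * (S - z a))"
    using sum_z[OF assms] finite_L[OF assms(1)]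
    by (simp add: exp_sum[symmetric] sum_distrib_left[symmetric])
  then show ?thesis by (simp add: mon_def prod.distrib)
qed

text \<open>
  The balance condition makes the weights \<open>z\<close> the exponents of the scaling under which every \<open>Ph a\<close> is homogeneous, of the
  common degree \<open>S - 1 \<le> 0\<close>.
\<close>

lemma Ph_scale:
  assumes "pos y" "a \<in> I"
  shows "Ph a (\<lambda>b. exp (\<theta> * z b) * y b) = exp (\<theta> * (S - 1)) * Ph a y"
proof -
  have F: "F a (\<lambda>b. exp (\<theta> * z b) * y b) = exp (\<theta> * (S - z a)) * F a y"
    unfolding F_def using mon_scale assms(2) by (simp add: sum_distrib_left mult_ac)
  have "exp (\<theta> * z a) powr (p a - 1) = exp (\<theta> * (1 - z a))"
    using p_times_z[OF assms(2)] by (simp add: powr_def algebra_simps)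
  then have pw: "(exp (\<theta> * z a) * y a) powr (p a - 1) = exp (\<theta> * (1 - z a)) * y a powr (p a - 1)"
    using assms by (simp add: powr_mult pos_def less_imp_le)
  have "exp (\<theta> * (S - z a)) / exp (\<theta> * (1 - z a)) = exp (\<theta> * (S - 1))"
    by (simp add: exp_diff[symmetric] algebra_simps)
  then show ?thesis unfolding Ph_def F pw by (simp add: field_simps)
qed

lemma F_mono:
  assumes "pos x" "\<And>b. b \<in> I \<Longrightarrow> x b \<le> y b" "a \<in> I"
  shows "F a x \<le> F a y"
  unfolding F_def mon_def
proof (intro sum_mono mult_left_mono prod_mono)
  show "0 \<le> x (e \<tau> l) \<and> x (e \<tau> l) \<le> y (e \<tau> l)" if "\<tau> \<in> T a" "l \<in> L a" for \<tau> l
    using e_in_I[OF assms(3) that] assms by (auto simp: pos_def less_imp_le)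
qed (use K_nonneg assms in auto)

lemma F_strict_mono:
  assumes "pos x" "\<And>b. b \<in> I \<Longrightarrow> x b \<le> y b" "(a, b) \<in> edges" "x b < y b"
  shows "F a x < F a y"
proof -
  from assms(3) obtain \<tau> l where \<tau>: "a \<in> I" "\<tau> \<in> T a" "0 < K \<tau>" "l \<in> L a" "b = e \<tau> l"
    by (auto simp: edges_def)
  have x: "0 < x (e \<tau>' l) \<and> x (e \<tau>' l) \<le> y (e \<tau>' l)" if "\<tau>' \<in> T a" "l \<in> L a" for \<tau>' l
    using e_in_I[OF \<tau>(1) that] assms by (auto simp: pos_def)
  have "mon a \<tau> x < mon a \<tau> y"
    unfolding mon_def using x \<tau> assms(4) finite_L
    by (intro prod_strict_mono_ex1[of _ _ _ l]) auto
  moreover have "mon a \<tau>' x \<le> mon a \<tau>' y" if "\<tau>' \<in> T a" for \<tau>'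
    unfolding mon_def using x that by (intro prod_mono) (auto simp: less_imp_le)
  ultimately show ?thesis
    unfolding F_def using \<tau> K_nonneg finite_T
    by (intro sum_strict_mono_ex1) (auto intro!: mult_left_mono bexI[of _ \<tau>])
qed

lemma Ph_mono:
  assumes "pos x" "\<And>b. b \<in> I \<Longrightarrow> x b \<le> y b" "a \<in> I" "x a = y a"
  shows "Ph a x \<le> Ph a y"
  using F_mono[OF assms(1-3)] assms by (simp add: Ph_def divide_right_mono)

subsection \<open>The normalising function\<close>

lemma finite_block: "finite (block k)"
  using finite_I by (simp add: block_def)

lemma block_pos:
  assumes "pos x" "a \<in> I"
  shows "0 < (\<Sum>b\<in>block (blk a). x b powr p b)"
  using assms by (intro sum_pos2[OF finite_block, of a]) (auto simp: block_def pos_def)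

lemma nrm_pos_eq:
  assumes "pos x"
  shows "nrm k x = (\<Sum>b\<in>block k. x b powr p b) powr (1 / q k)"
  using assms unfolding nrm_def
  by (intro arg_cong2[of _ _ _ _ "(powr)"] sum.cong) (auto simp: block_def pos_def)

lemma nrm_pos: "pos x \<Longrightarrow> k \<in> blk ` I \<Longrightarrow> 0 < nrm k x"
  using block_pos[of x] by (auto simp: nrm_pos_eq dest!: less_imp_neq[OF block_pos])

lemma cc_pos: "pos x \<Longrightarrow> 0 < cc x"
  unfolding cc_def using nrm_pos by (intro prod_pos) blast

lemma card_blocks: "0 < card (blk ` I)"
  using finite_I I_nonempty by (simp add: card_gt_0_iff)

lemma cc_scale:
  assumes "0 < t"
  shows "cc (\<lambda>a. x a * t) = cc x * t ^ card (blk ` I)"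
proof -
  have "nrm k (\<lambda>a. x a * t) = nrm k x * t" if "k \<in> blk ` I" for k
  proof -
    have k: "0 < q k" using that p_gt_0 by blast
    have "(\<Sum>a\<in>block k. \<bar>x a * t\<bar> powr q k) = (\<Sum>a\<in>block k. \<bar>x a\<bar> powr q k) * t powr q k"
      using assms by (simp add: abs_mult powr_mult sum_distrib_right)
    then show ?thesis
      using k assms by (simp add: nrm_def powr_mult sum_nonneg powr_powr)
  qed
  then show ?thesis by (simp add: cc_def prod.distrib)
qed

lemma rn_alt: "rn x = (\<lambda>a. x a * inverse (root (card (blk ` I)) (cc x)))"
  by (simp add: rn_def divide_inverse)

lemma root_cc_pos: "pos x \<Longrightarrow> 0 < root (card (blk ` I)) (cc x)"
  using cc_pos card_blocks by simp

lemma cc_rn: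
  assumes "pos x"
  shows "cc (rn x) = 1"
proof -
  have "cc (rn x) = cc x * inverse (root (card (blk ` I)) (cc x)) ^ card (blk ` I)"
    unfolding rn_alt using root_cc_pos[OF assms] by (intro cc_scale) simp
  also have "\<dots> = 1"
    using card_blocks cc_pos[OF assms] by (simp add: power_inverse)
  finally show ?thesis .
qed

lemma pos_rn: "pos x \<Longrightarrow> pos (rn x)"
  using root_cc_pos[of x] by (simp add: rn_def pos_def)

lemma rn_id: "cc x = 1 \<Longrightarrow> rn x = x"
  using card_blocks by (simp add: rn_def)

lemma nrm_mono:
  assumes "pos x" "\<And>b. b \<in> I \<Longrightarrow> x b \<le> y b" "k \<in> blk ` I"
  shows "nrm k x \<le> nrm k y"
proof -
  have "0 < q k" using assms(3) p_gt_0 by blast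
  moreover have "\<bar>x a\<bar> \<le> \<bar>y a\<bar>" if "a \<in> block k" for a
    using assms that by (force simp: block_def pos_def)
  ultimately show ?thesis
    unfolding nrm_def by (intro powr_mono2 sum_mono sum_nonneg) auto
qed

text \<open>
  The comparison arguments below end here: two points with equal normalisation cannot be ordered unless they agree.
\<close>

lemma cc_strict_mono:
  assumes "pos x" "\<And>b. b \<in> I \<Longrightarrow> x b \<le> y b" "a \<in> I" "x a < y a"
  shows "cc x < cc y"
proof -
  have y: "pos y" using assms by (force simp: pos_def)
  have "(\<Sum>b\<in>block (blk a). x b powr p b) < (\<Sum>b\<in>block (blk a). y b powr p b)"
  proof (intro sum_strict_mono_ex1[OF finite_block] ballI bexI)
    show "x b powr p b \<le> y b powr p b" if "b \<in> block (blk a)" for b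
      using that assms p_gt_0[of b] by (intro powr_mono2) (auto simp: block_def pos_def less_imp_le)
    show "x a powr p a < y a powr p a"
      using assms p_gt_0[of a] by (intro powr_less_mono2) (auto simp: pos_def less_imp_le)
    show "a \<in> block (blk a)" using assms by (simp add: block_def)
  qed
  then have "nrm (blk a) x < nrm (blk a) y"
    unfolding nrm_pos_eq[OF assms(1)] nrm_pos_eq[OF y]
    using p_gt_0[OF assms(3)] block_pos[OF assms(1,3)] by (intro powr_less_mono2) auto
  then show ?thesis
    unfolding cc_def using finite_I assms nrm_pos nrm_mono
    by (intro prod_strict_mono_ex1[of _ _ _ "blk a"]) auto
qed

lemma coord_le_nrm:
  assumes "pos x" "a \<in> I"
  shows "x a \<le> nrm (blk a) x"
proof -
  have "x a powr p a \<le> (\<Sum>b\<in>block (blk a). x b powr p b)"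
    using assms by (intro member_le_sum finite_block) (auto simp: block_def)
  then have "(x a powr p a) powr (1 / p a) \<le> nrm (blk a) x"
    unfolding nrm_pos_eq[OF assms(1)] using p_gt_0[OF assms(2)] by (intro powr_mono2) auto
  then show ?thesis
    using p_gt_0[OF assms(2)] assms by (simp add: powr_powr pos_def less_imp_le)
qed

subsection \<open>Derivatives in logarithmic coordinates\<close>

lemma F_has_derivative:
  assumes X: "\<And>b. b \<in> I \<Longrightarrow> ((\<lambda>t. X t b) has_real_derivative X' b) (at t)"
    and pos: "pos (X t)" and a: "a \<in> I"
  shows "((\<lambda>t. F a (X t)) has_real_derivative dF a (X t) (\<lambda>b. X' b / X t b)) (at t)"
proof -
  have "((\<lambda>t. mon a \<tau> (X t)) has_real_derivative
      mon a \<tau> (X t) * (\<Sum>l\<in>L a. X' (e \<tau> l) / X t (e \<tau> l))) (at t)" if "\<tau> \<in> T a" for \<tau>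
    unfolding mon_def using e_in_I[OF a that] X posD[OF pos e_in_I[OF a that]]
    by (intro has_field_derivative_prod') force+
  from DERIV_sum[of "T a", OF DERIV_cmult[OF this]] show ?thesis
    unfolding F_def dF_def by (simp add: mult_ac)
qed

lemma Ph_has_derivative:
  assumes X: "\<And>b. b \<in> I \<Longrightarrow> ((\<lambda>t. X t b) has_real_derivative X' b) (at t)"
    and pos: "pos (X t)" and a: "a \<in> I"
  shows "((\<lambda>t. Ph a (X t)) has_real_derivative dPh a (X t) (\<lambda>b. X' b / X t b)) (at t)"
proof -
  have xa: "0 < X t a" using pos a by (simp add: pos_def)
  have pw: "((\<lambda>t. X t a powr (p a - 1)) has_real_derivative
      (p a - 1) * X t a powr (p a - 1) * (X' a / X t a)) (at t)"
  proof -
    have "(p a - 1) * X t a powr (p a - 1 - of_nat 1) * X' a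
        = (p a - 1) * X t a powr (p a - 1) * (X' a / X t a)"
      using xa powr_diff[of "X t a" "p a - 1" 1] by simp
    then show ?thesis using DERIV_fun_powr[OF X[OF a] xa, of "p a - 1"] by simp
  qed
  have nz: "X t a powr (p a - 1) \<noteq> 0" using xa by simp
  have quot: "((\<lambda>t. Ph a (X t)) has_real_derivative
     (dF a (X t) (\<lambda>b. X' b / X t b) * X t a powr (p a - 1) - F a (X t) *
        ((p a - 1) * X t a powr (p a - 1) * (X' a / X t a)))
      / (X t a powr (p a - 1) * X t a powr (p a - 1))) (at t)"
    unfolding Ph_def using DERIV_divide[OF F_has_derivative[OF X pos a] pw nz] by blast
  have alg: "(D * P - F' * ((p a - 1) * P * V)) / (P * P) = F' / P * (D / F' - (p a - 1) * V)"
    if "0 < P" "0 < F'" for D P F' V :: real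
    using that by (simp add: field_simps)
  have "0 < X t a powr (p a - 1)" using xa by simp
  from alg[OF this F_pos[OF pos a]] quot show ?thesis
    by (simp only: dPh_def Ph_def[of a "X t"])
qed

lemma sum_blocks: "(\<Sum>k\<in>blk ` I. \<Sum>b\<in>block k. f b) = (\<Sum>b\<in>I. f b)"
  unfolding block_def by (rule sum.group) (auto simp: finite_I)

lemma cc_has_derivative:
  assumes X: "\<And>b. b \<in> I \<Longrightarrow> ((\<lambda>t. X t b) has_real_derivative X' b) (at t)"
    and pos: "pos (X t)"
  shows "((\<lambda>t. cc (X t)) has_real_derivative cc (X t) * W (X t) (\<lambda>b. X' b / X t b)) (at t)"
proof -
  define Q where "Q k = (\<Sum>b\<in>block k. X t b powr p b)" for k
  have nrm: "((\<lambda>t. nrm k (X t)) has_real_derivative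
      nrm k (X t) * (\<Sum>b\<in>block k. w (X t) b * (X' b / X t b))) (at t)" if k: "k \<in> blk ` I" for k
  proof -
    have qk: "0 < q k" using k p_gt_0 by blast
    have Qk: "0 < Q k" using k block_pos[OF pos] by (auto simp: Q_def)
    have ab: "((\<lambda>t. \<bar>X t b\<bar>) has_real_derivative X' b) (at t)" if "b \<in> block k" for b
    proof -
      have b: "b \<in> I" using that by (simp add: block_def)
      then have "0 < X t b" using pos by (simp add: pos_def)
      moreover have "((\<lambda>t. X t b) \<longlongrightarrow> X t b) (nhds t)"
        using DERIV_isCont[OF X[OF b]] unfolding continuous_at
        by (subst (asm) tendsto_at_iff_tendsto_nhds[of "\<lambda>t. X t b" t])
      ultimately have "\<forall>\<^sub>F t' in nhds t. 0 < X t' b" using order_tendstoD(1) by blast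
      then have "\<forall>\<^sub>F t' in nhds t. \<bar>X t' b\<bar> = X t' b" by eventually_elim simp
      from DERIV_cong_ev[OF refl this refl] show ?thesis using X[OF b] by blast
    qed
    have "((\<lambda>t. \<bar>X t b\<bar> powr q k) has_real_derivative
        q k * (X t b powr p b * (X' b / X t b))) (at t)" if b: "b \<in> block k" for b
    proof -
      have xb: "0 < X t b" "q k = p b" using pos b by (auto simp: pos_def block_def)
      then have "((\<lambda>t. \<bar>X t b\<bar> powr q k) has_real_derivative
        q k * \<bar>X t b\<bar> powr (q k - of_nat 1) * X' b) (at t)"
        by (intro DERIV_fun_powr ab b) auto
      then show ?thesis using xb by (simp add: powr_diff field_simps)
    qed
    from DERIV_sum[of "block k", OF this]
    have sumD: "((\<lambda>t. \<Sum>b\<in>block k. \<bar>X t b\<bar> powr q k) has_real_derivative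
        q k * (\<Sum>b\<in>block k. X t b powr p b * (X' b / X t b))) (at t)"
      by (simp add: sum_distrib_left)
    have eqQ: "(\<Sum>b\<in>block k. \<bar>X t b\<bar> powr q k) = Q k"
      unfolding Q_def using pos by (intro sum.cong) (auto simp: block_def pos_def)
    have "((\<lambda>t. nrm k (X t)) has_real_derivative
        1 / q k * Q k powr (1 / q k - of_nat 1) *
          (q k * (\<Sum>b\<in>block k. X t b powr p b * (X' b / X t b)))) (at t)"
      unfolding nrm_def using DERIV_fun_powr[OF sumD, of "1 / q k"] Qk unfolding eqQ by blast
    moreover have "(\<Sum>b\<in>block k. w (X t) b * (X' b / X t b))
        = (\<Sum>b\<in>block k. X t b powr p b * (X' b / X t b)) / Q k"
      unfolding sum_divide_distrib by (intro sum.cong) (auto simp: w_def Q_def block_def)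
    moreover have "nrm k (X t) = Q k powr (1 / q k)"
      unfolding nrm_pos_eq[OF pos] Q_def ..
    ultimately show ?thesis
      using qk Qk by (simp add: powr_diff)
  qed
  have "((\<lambda>t. cc (X t)) has_real_derivative cc (X t) *
     (\<Sum>k\<in>blk ` I. nrm k (X t) * (\<Sum>b\<in>block k. w (X t) b * (X' b / X t b)) / nrm k (X t))) (at t)"
    unfolding cc_def using nrm nrm_pos[OF pos]
    by (intro has_field_derivative_prod') force+
  also have "(\<Sum>k\<in>blk ` I. nrm k (X t) * (\<Sum>b\<in>block k. w (X t) b * (X' b / X t b)) / nrm k (X t))
      = (\<Sum>k\<in>blk ` I. \<Sum>b\<in>block k. w (X t) b * (X' b / X t b))"
    using nrm_pos[OF pos] by (intro sum.cong) force+
  also have "\<dots> = W (X t) (\<lambda>b. X' b / X t b)"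
    unfolding sum_blocks W_def ..
  finally show ?thesis .
qed

subsection \<open>The maximum principle\<close>

lemma dF_cmult: "dF a x (\<lambda>b. t * v b) = t * dF a x v"
  unfolding dF_def by (simp add: sum_distrib_left mult_ac)

lemma dF_sum: "dF a x (\<lambda>b. \<Sum>j\<in>J. f j b) = (\<Sum>j\<in>J. dF a x (f j))"
proof -
  have "dF a x (\<lambda>b. \<Sum>j\<in>J. f j b)
      = (\<Sum>\<tau>\<in>T a. \<Sum>j\<in>J. K \<tau> * mon a \<tau> x * (\<Sum>l\<in>L a. f j (e \<tau> l)))"
    unfolding dF_def by (subst sum.swap) (simp add: sum_distrib_left)
  then show ?thesis
    unfolding dF_def by (subst (asm) sum.swap)
qed

lemma dPh_cmult: "dPh a x (\<lambda>b. t * v b) = t * dPh a x v"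
  unfolding dPh_def dF_cmult by (simp add: algebra_simps)

lemma dPh_sum: "dPh a x (\<lambda>b. \<Sum>j\<in>J. f j b) = (\<Sum>j\<in>J. dPh a x (f j))"
  unfolding dPh_def dF_sum
  by (simp add: sum_distrib_left sum_divide_distrib sum_subtractf right_diff_distrib)

lemma dF_cong: "(\<And>b. b \<in> I \<Longrightarrow> v b = u b) \<Longrightarrow> a \<in> I \<Longrightarrow> dF a x v = dF a x u"
  unfolding dF_def using e_in_I by (intro sum.cong arg_cong2[of _ _ _ _ "(*)"]) auto

lemma dPh_cong: "(\<And>b. b \<in> I \<Longrightarrow> v b = u b) \<Longrightarrow> a \<in> I \<Longrightarrow> dPh a x v = dPh a x u"
  using dF_cong[of v u a x] by (simp add: dPh_def)

lemma W_cmult: "W x (\<lambda>b. t * v b) = t * W x v"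
  unfolding W_def by (simp add: sum_distrib_left mult_ac)

lemma w_pos: "pos x \<Longrightarrow> a \<in> I \<Longrightarrow> 0 < w x a"
  unfolding w_def using posD block_pos by (intro divide_pos_pos) force+

lemma W_nonpos_eq_0:
  assumes "pos x" "\<And>a. a \<in> I \<Longrightarrow> v a \<le> 0" "W x v = 0" "a \<in> I"
  shows "v a = 0"
proof -
  have "(\<Sum>a\<in>I. w x a * - v a) = 0"
    using assms(3) by (simp add: W_def sum_negf)
  moreover have "0 \<le> w x a * - v a" if "a \<in> I" for a
    using w_pos[OF assms(1) that] assms(2)[OF that] by (intro mult_nonneg_nonneg) auto
  ultimately have "w x a * - v a = 0"
    using sum_nonneg_eq_0_iff[OF finite_I, of "\<lambda>a. w x a * - v a"] assms(4) by blast
  then show ?thesis using w_pos[OF assms(1,4)] by simp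
qed

lemma dF_mono:
  assumes "pos x" "\<And>b. b \<in> I \<Longrightarrow> v b \<le> u b" "a \<in> I"
  shows "dF a x v \<le> dF a x u"
  unfolding dF_def
proof (intro sum_mono mult_left_mono)
  show "0 \<le> K \<tau> * mon a \<tau> x" if "\<tau> \<in> T a" for \<tau>
    using K_nonneg[OF assms(3) that] mon_pos[OF assms(1,3) that] by simp
qed (use e_in_I assms in blast)

lemma dF_strict_mono:
  assumes "pos x" "\<And>b. b \<in> I \<Longrightarrow> v b \<le> u b" "(a, b) \<in> edges" "v b < u b"
  shows "dF a x v < dF a x u"
proof -
  from assms(3) obtain \<tau> l where \<tau>: "a \<in> I" "\<tau> \<in> T a" "0 < K \<tau>" "l \<in> L a" "b = e \<tau> l"
    by (auto simp: edges_def)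
  have coef: "0 \<le> K \<tau>' * mon a \<tau>' x" if "\<tau>' \<in> T a" for \<tau>'
    using K_nonneg[OF \<tau>(1) that] mon_pos[OF assms(1) \<tau>(1) that] by simp
  have le: "v (e \<tau>' l') \<le> u (e \<tau>' l')" if "\<tau>' \<in> T a" "l' \<in> L a" for \<tau>' l'
    using e_in_I[OF \<tau>(1) that] assms by blast
  have "(\<Sum>l\<in>L a. v (e \<tau> l)) < (\<Sum>l\<in>L a. u (e \<tau> l))"
    using \<tau> assms(4) le finite_L by (intro sum_strict_mono_ex1) auto
  moreover have "0 < mon a \<tau> x" using \<tau> mon_pos assms(1) by simp
  ultimately show ?thesis
    unfolding dF_def using \<tau> finite_T coef le
    by (intro sum_strict_mono_ex1) (auto intro!: mult_left_mono sum_mono bexI[of _ \<tau>])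
qed

lemma dF_z:
  assumes "a \<in> I"
  shows "dF a x (\<lambda>b. \<theta> * z b) = \<theta> * (S - z a) * F a x"
proof -
  have "(\<Sum>l\<in>L a. \<theta> * z (e \<tau> l)) = \<theta> * (S - z a)" if "\<tau> \<in> T a" for \<tau>
    using sum_z[OF assms that] by (simp add: sum_distrib_left[symmetric])
  then show ?thesis
    unfolding dF_def F_def by (simp add: sum_distrib_left mult_ac)
qed

text \<open>
  A property that passes from \<open>a\<close> to the variables of row \<open>a\<close> spreads to all coordinates.
\<close>

lemma edges_connected:
  assumes "S = 1" "a \<in> I" "b \<in> I" "Q a"
    and step: "\<And>a b. a \<in> I \<Longrightarrow> b \<in> I \<Longrightarrow> (a, b) \<in> edges \<Longrightarrow> Q a \<Longrightarrow> Q b"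
  shows "Q b"
proof -
  have inI: "a \<in> I \<and> b \<in> I" if "(a, b) \<in> edges" for a b
    using that e_in_I by (auto simp: edges_def)
  have "(a, b) \<in> edges\<^sup>+"
    using strongly_connected assms unfolding edges_def by blast
  then show ?thesis
    by (induction rule: trancl_induct) (use assms(4) step inI in blast)+
qed

text \<open>
  Take the largest weighted velocity \<open>\<theta> = p a * v a\<close>, so that \<open>v \<le> \<theta> z\<close> with equality at \<open>a\<close>.  If
  \<open>\<theta> > 0\<close>, monotonicity of \<open>dF\<close> gives \<open>dPh a x v \<le> \<theta> (S - 1) Ph a x\<close>, while the assumption makes
  the left side nonnegative.  So \<open>S = 1\<close> and equality holds, which forces \<open>v b = \<theta> z b\<close> for each variable
  \<open>b\<close> of row \<open>a\<close> and then, by connectedness, everywhere; a direction that is positive everywhere is not tangent.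
  Hence \<open>v \<le> 0\<close>, and tangency makes it zero.
\<close>

lemma max_principle:
  assumes x: "pos x" and le: "\<And>a. a \<in> I \<Longrightarrow> Ph a x \<le> lam" and W: "W x v = 0"
    and super: "\<And>a. a \<in> I \<Longrightarrow> (lam - Ph a x) * v a \<le> dPh a x v"
    and a: "a \<in> I"
  shows "v a = 0"
proof -
  define \<theta> where "\<theta> = Max ((\<lambda>a. p a * v a) ` I)"
  have v_le: "v b \<le> \<theta> * z b" if "b \<in> I" for b
  proof -
    have "p b * v b \<le> \<theta>" unfolding \<theta>_def using finite_I that by (intro Max_ge) auto
    then show ?thesis using p_gt_0[OF that] by (simp add: z_def field_simps)
  qed
  have "\<theta> \<le> 0"
  proof (rule ccontr)
    assume "\<not> \<theta> \<le> 0"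
    then have \<theta>: "0 < \<theta>" by simp
    have extremal: "S = 1 \<and> dF b x v = \<theta> * (S - z b) * F b x" if b: "b \<in> I" "v b = \<theta> * z b" for b
    proof -
      have "0 \<le> (lam - Ph b x) * v b"
        using le[OF b(1)] b(2) \<theta> z_pos[OF b(1)] by simp
      also have "\<dots> \<le> dPh b x v" by (rule super[OF b(1)])
      finally have "0 \<le> dF b x v / F b x - (p b - 1) * v b"
        using Ph_pos[OF x b(1)] by (simp add: dPh_def zero_le_mult_iff)
      moreover have "(p b - 1) * v b = \<theta> * (1 - z b)"
        using p_times_z[OF b(1)] b(2) by (simp add: algebra_simps)
      ultimately have lower: "\<theta> * (1 - z b) * F b x \<le> dF b x v"
        using F_pos[OF x b(1)] by (simp add: pos_le_divide_eq)
      have upper: "dF b x v \<le> \<theta> * (S - z b) * F b x"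
        using dF_mono[of x v "\<lambda>b. \<theta> * z b", OF x v_le b(1)] dF_z[OF b(1)] by simp
      have "\<theta> * (1 - z b) * F b x \<le> \<theta> * (S - z b) * F b x" using lower upper by linarith
      then have "1 - z b \<le> S - z b"
        using \<theta> F_pos[OF x b(1)] by simp
      then have "S = 1" using S_le_1 by linarith
      then show ?thesis using lower upper by simp
    qed
    have "\<theta> \<in> (\<lambda>a. p a * v a) ` I"
      unfolding \<theta>_def using finite_I I_nonempty by (intro Max_in) auto
    then obtain a0 where a0: "a0 \<in> I" "v a0 = \<theta> * z a0"
      using p_gt_0 by (force simp: z_def)
    have S: "S = 1" using extremal[OF a0] by blast
    have all: "v b = \<theta> * z b" if "b \<in> I" for b
    proof (rule edges_connected[OF S a0(1) that, of "\<lambda>b. v b = \<theta> * z b"])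
      show "v a0 = \<theta> * z a0" by (rule a0)
    next
      fix a b assume ab: "a \<in> I" "b \<in> I" "(a, b) \<in> edges" "v a = \<theta> * z a"
      show "v b = \<theta> * z b"
      proof (rule ccontr)
        assume "v b \<noteq> \<theta> * z b"
        then have "v b < \<theta> * z b" using v_le[OF ab(2)] by simp
        from dF_strict_mono[of x v "\<lambda>b. \<theta> * z b", OF x v_le ab(3) this] show False
          using extremal[OF ab(1,4)] dF_z[OF ab(1)] by simp
      qed
    qed
    have "0 < W x v"
      unfolding W_def using finite_I I_nonempty w_pos[OF x] all z_pos \<theta>
      by (intro sum_pos) auto
    with W show False by simp
  qed
  then have "v b \<le> 0" if "b \<in> I" for b
    using v_le[OF that] z_pos[OF that] by (meson less_imp_le mult_nonpos_nonneg order_trans)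
  then show ?thesis using W_nonpos_eq_0[OF x _ W a] by blast
qed

subsection \<open>Newton directions\<close>

text \<open>
  The Newton system for \<open>H\<close> at \<open>(x, ph x)\<close> with \<open>cc x = 1\<close>, after division of row \<open>a\<close> by \<open>x a\<close> and
  with \<open>v = d / x\<close>.
\<close>

definition newton :: "('a \<Rightarrow> real) \<Rightarrow> ('a \<Rightarrow> real) \<Rightarrow> real \<Rightarrow> bool" where
  "newton x v \<delta> \<longleftrightarrow> W x v = 0 \<and> (\<forall>a\<in>I. (ph x - Ph a x) * (v a + 1) + \<delta> = dPh a x v)"

lemma dPh_0: "(\<And>b. b \<in> I \<Longrightarrow> v b = 0) \<Longrightarrow> a \<in> I \<Longrightarrow> dPh a x v = 0"
  using dPh_cmult[of a x 0 v] dPh_cong[of v "\<lambda>b. 0 * v b" a x] by simp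

text \<open>
  For \<open>\<delta> \<ge> 0\<close> the Newton equations imply the inequality of the maximum principle, because
  \<open>ph x - Ph a x \<ge> 0\<close>; with \<open>v = 0\<close> they reduce to \<open>ph x - Ph a x + \<delta> = 0\<close>.
\<close>

lemma newton_decrease_nonneg:
  assumes "pos x" "newton x v \<delta>" "0 \<le> \<delta>"
  shows "\<delta> = 0 \<and> (\<forall>a\<in>I. v a = 0 \<and> Ph a x = ph x)"
proof -
  have eq: "(ph x - Ph a x) * (v a + 1) + \<delta> = dPh a x v" if "a \<in> I" for a
    using assms(2) that by (simp add: newton_def)
  have v0: "v a = 0" if "a \<in> I" for a
  proof (rule max_principle[OF assms(1) Ph_le_ph _ _ that])
    show "W x v = 0" using assms(2) by (simp add: newton_def)
    show "(ph x - Ph a x) * v a \<le> dPh a x v" if "a \<in> I" for a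
      using eq[OF that] Ph_le_ph[OF that, of x] assms(3) by (simp add: algebra_simps)
  qed
  have "(ph x - Ph a x) + \<delta> = 0" if "a \<in> I" for a
    using eq[OF that] dPh_0[of v a x] v0 that by simp
  then have "\<delta> = 0 \<and> Ph a x = ph x" if "a \<in> I" for a
    using that Ph_le_ph[OF that, of x] assms(3) by fastforce
  then show ?thesis using v0 I_nonempty by blast
qed

lemma newton_decrease_nonpos: "pos x \<Longrightarrow> newton x v \<delta> \<Longrightarrow> \<delta> \<le> 0"
  using newton_decrease_nonneg[of x v \<delta>] by linarith

text \<open>
  The homogeneous Newton system.  Changing the signs of \<open>v\<close> and \<open>\<delta>\<close> makes \<open>\<delta> \<ge> 0\<close>, and then the
  maximum principle applies.
\<close>

lemma newton_matrix_injective: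
  assumes x: "pos x" and W: "W x v = 0"
    and eq: "\<And>a. a \<in> I \<Longrightarrow> (ph x - Ph a x) * v a + \<delta> = dPh a x v"
  shows "\<delta> = 0 \<and> (\<forall>a\<in>I. v a = 0)"
proof -
  have nonneg: "\<forall>a\<in>I. v a = 0"
    if "0 \<le> \<delta>" "W x v = 0" and eq: "\<And>a. a \<in> I \<Longrightarrow> (ph x - Ph a x) * v a + \<delta> = dPh a x v" for v \<delta>
  proof
    fix a assume "a \<in> I"
    show "v a = 0"
    proof (rule max_principle[OF x Ph_le_ph that(2) _ \<open>a \<in> I\<close>])
      show "(ph x - Ph b x) * v b \<le> dPh b x v" if "b \<in> I" for b
        using eq[OF that] \<open>0 \<le> \<delta>\<close> by linarith
    qed
  qed
  have v0: "\<forall>a\<in>I. v a = 0"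
  proof (cases "0 \<le> \<delta>")
    case True
    then show ?thesis using nonneg W eq by blast
  next
    case False
    have "\<forall>a\<in>I. - 1 * v a = 0"
    proof (rule nonneg[of "- \<delta>"])
      show "(ph x - Ph a x) * (- 1 * v a) + - \<delta> = dPh a x (\<lambda>a. - 1 * v a)" if "a \<in> I" for a
        unfolding dPh_cmult eq[OF that, symmetric] by (simp add: algebra_simps)
      show "W x (\<lambda>a. - 1 * v a) = 0" unfolding W_cmult using W by simp
      show "0 \<le> - \<delta>" using False by simp
    qed
    then show ?thesis by simp
  qed
  then have "\<delta> = 0" if "a \<in> I" for a
    using eq[OF that] dPh_0[of v a x] that by simp
  then show ?thesis using v0 I_nonempty by blast
qed

subsection \<open>Uniqueness\<close>

text \<open>
  Let \<open>\<theta>\<close> be least such that \<open>x\<close> lies below \<open>y' = exp (\<theta> z) y\<close>.  At a coordinate where \<open>x\<close> and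
  \<open>y'\<close> touch, monotonicity gives \<open>Ph a x \<le> Ph a y' = exp (\<theta> (S - 1)) Ph a y\<close>.  For \<open>\<theta> > 0\<close> this is
  a strict inequality between the constants unless \<open>S = 1\<close> and contact spreads to all coordinates, which would
  put \<open>x\<close> strictly above \<open>y\<close> and contradict \<open>cc x = cc y\<close>.  For \<open>\<theta> \<le> 0\<close> the point \<open>x\<close> lies
  below \<open>y\<close>, and \<open>cc x = cc y\<close> leaves only equality.
\<close>

lemma constant_Ph_compare:
  assumes x: "pos x" and y: "pos y" and c: "cc x = cc y"
    and lam: "\<And>a. a \<in> I \<Longrightarrow> Ph a x = lam" and \<mu>: "\<And>a. a \<in> I \<Longrightarrow> Ph a y = \<mu>"
  shows "(\<forall>a\<in>I. x a = y a) \<or> lam < \<mu>"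
proof -
  define u where "u a = p a * ln (x a / y a)" for a
  define \<theta> where "\<theta> = Max (u ` I)"
  define y' where "y' = (\<lambda>b. exp (\<theta> * z b) * y b)"
  have x_u: "x b = exp (u b * z b) * y b" if "b \<in> I" for b
    using posD[OF x that] posD[OF y that] p_gt_0[OF that]
    by (simp add: u_def z_def)
  have x_le: "x b \<le> y' b" if "b \<in> I" for b
  proof -
    have "u b \<le> \<theta>" unfolding \<theta>_def using finite_I that by (intro Max_ge) auto
    then show ?thesis
      unfolding x_u[OF that] y'_def
      using posD[OF y that] z_pos[OF that] by (intro mult_right_mono) auto
  qed
  have "\<theta> \<in> u ` I" unfolding \<theta>_def using finite_I I_nonempty by (intro Max_in) auto
  then obtain a0 where a0: "a0 \<in> I" "x a0 = y' a0" using x_u by (auto simp: y'_def)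
  have y'_pos: "pos y'" using y by (simp add: y'_def pos_def)
  have "lam \<le> exp (\<theta> * (S - 1)) * \<mu>"
    using Ph_mono[OF x x_le a0] lam[OF a0(1)] \<mu>[OF a0(1)] Ph_scale[OF y a0(1), of \<theta>]
    by (simp add: y'_def)
  have \<mu>_pos: "0 < \<mu>" using Ph_pos[OF y a0(1)] \<mu>[OF a0(1)] by simp
  show ?thesis
  proof (cases "\<theta> \<le> 0")
    case True
    have le: "x b \<le> y b" if "b \<in> I" for b
    proof -
      have "exp (\<theta> * z b) \<le> 1" using True z_pos[OF that] by (simp add: mult_nonpos_nonneg)
      then have "y' b \<le> y b" using posD[OF y that] by (simp add: y'_def)
      then show ?thesis using x_le[OF that] by simp
    qed
    have "x a = y a" if "a \<in> I" for a
      using cc_strict_mono[OF x le that] le[OF that] c by force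
    then show ?thesis by blast
  next
    case False
    then have \<theta>: "0 < \<theta>" by simp
    have "lam < \<mu>"
    proof (rule ccontr)
      assume "\<not> lam < \<mu>"
      then have "\<mu> \<le> exp (\<theta> * (S - 1)) * \<mu>"
        using \<open>lam \<le> exp (\<theta> * (S - 1)) * \<mu>\<close> by simp
      then have "0 \<le> \<theta> * (S - 1)" using \<mu>_pos by simp
      then have S: "S = 1" using \<theta> S_le_1 by (simp add: zero_le_mult_iff)
      have all: "x b = y' b" if "b \<in> I" for b
      proof (rule edges_connected[OF S a0(1) that, of "\<lambda>b. x b = y' b"])
        show "x a0 = y' a0" by (rule a0)
      next
        fix a b assume ab: "a \<in> I" "b \<in> I" "(a, b) \<in> edges" "x a = y' a"
        have "lam = Ph a x" "\<mu> = Ph a y'"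
          using lam[OF ab(1)] \<mu>[OF ab(1)] Ph_scale[OF y ab(1), of \<theta>] S by (simp_all add: y'_def)
        then have "\<not> F a x < F a y'"
          using \<open>\<not> lam < \<mu>\<close> ab(4) posD[OF y'_pos ab(1)]
            divide_strict_right_mono[of "F a x" "F a y'" "y' a powr (p a - 1)"]
          by (auto simp: Ph_def)
        then show "x b = y' b"
          using F_strict_mono[OF x x_le ab(3)] x_le[OF ab(2)] by force
      qed
      have y_less: "y b < x b" if "b \<in> I" for b
        using all[OF that] \<theta> z_pos[OF that] posD[OF y that] by (simp add: y'_def)
      have "cc y < cc x"
        using y_less a0(1) by (intro cc_strict_mono[OF y _ a0(1)]) (auto intro: less_imp_le)
      with c show False by simp
    qed
    then show ?thesis ..
  qed
qed

lemma constant_Ph_unique: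
  assumes "pos x" "pos y" "cc x = cc y"
    and "\<And>a. a \<in> I \<Longrightarrow> Ph a x = lam" "\<And>a. a \<in> I \<Longrightarrow> Ph a y = \<mu>" "a \<in> I"
  shows "x a = y a"
  using constant_Ph_compare[OF assms(1-5)] constant_Ph_compare[OF assms(2,1) assms(3)[symmetric] assms(5,4)]
    assms(6) by force

subsection \<open>Sublevel sets\<close>

lemma scaled_minimum:
  assumes "pos x"
  obtains \<theta> a where "a \<in> I" "x a = exp (\<theta> * z a)" "\<And>b. b \<in> I \<Longrightarrow> exp (\<theta> * z b) \<le> x b"
proof -
  define u where "u a = p a * ln (x a)" for a
  define \<theta> where "\<theta> = Min (u ` I)"
  have x_u: "x b = exp (u b * z b)" if "b \<in> I" for b
    using posD[OF assms that] p_gt_0[OF that] by (simp add: u_def z_def)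
  have "exp (\<theta> * z b) \<le> x b" if "b \<in> I" for b
  proof -
    have "\<theta> \<le> u b" unfolding \<theta>_def using finite_I that by (intro Min_le) auto
    then show ?thesis unfolding x_u[OF that] using z_pos[OF that] by simp
  qed
  moreover have "\<theta> \<in> u ` I" unfolding \<theta>_def using finite_I I_nonempty by (intro Min_in) auto
  then obtain a where "a \<in> I" "x a = exp (\<theta> * z a)" using x_u by blast
  ultimately show thesis using that by blast
qed

text \<open>
  All coordinates being at least \<open>1\<close>, a variable is bounded by any monomial that contains it, hence, up to the
  coefficient of a term, by \<open>F a y = Ph a y * y a powr (p a - 1)\<close>.
\<close>

lemma edge_bound:
  assumes "(a, b) \<in> edges"
  shows "\<exists>B'. \<forall>y. (\<forall>b\<in>I. 1 \<le> y b) \<and> Ph a y \<le> \<Lambda> \<and> y a \<le> B \<longrightarrow> y b \<le> B'"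
proof -
  from assms obtain \<tau> l where \<tau>: "a \<in> I" "\<tau> \<in> T a" "0 < K \<tau>" "l \<in> L a" "b = e \<tau> l"
    by (auto simp: edges_def)
  have "y b \<le> \<Lambda> * B powr (p a - 1) / K \<tau>"
    if y: "\<forall>b\<in>I. 1 \<le> y b" and le: "Ph a y \<le> \<Lambda>" and B: "y a \<le> B" for y
  proof -
    have pos: "pos y" using y by (force simp: pos_def)
    have y1: "1 \<le> y (e \<tau> l')" if "l' \<in> L a" for l' using y e_in_I \<tau> that by blast
    have "1 * y b \<le> (\<Prod>l'\<in>L a - {l}. y (e \<tau> l')) * y b"
      using y1 \<tau> by (intro mult_right_mono prod_ge_1) force+
    also have "\<dots> = mon a \<tau> y"
      unfolding mon_def using prod.remove[OF finite_L[OF \<tau>(1)] \<tau>(4), of "\<lambda>l. y (e \<tau> l)"] \<tau>(5)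
      by (simp add: mult.commute)
    finally have "K \<tau> * y b \<le> K \<tau> * mon a \<tau> y" using \<tau> by simp
    also have "\<dots> \<le> F a y"
      unfolding F_def using \<tau> finite_T K_nonneg mon_pos[OF pos]
      by (intro member_le_sum) (auto intro!: mult_nonneg_nonneg less_imp_le[OF mon_pos[OF pos]])
    also have "\<dots> = Ph a y * y a powr (p a - 1)"
      using posD[OF pos \<tau>(1)] by (simp add: Ph_def)
    also have "\<dots> \<le> \<Lambda> * B powr (p a - 1)"
      using le Ph_pos[OF pos \<tau>(1)] posD[OF pos \<tau>(1)] B q_gt_1[OF \<tau>(1)]
      by (intro mult_mono powr_mono2) auto
    finally show ?thesis using \<tau> by (simp add: field_simps)
  qed
  then show ?thesis by blast
qed

lemma connected_bound:
  assumes S: "S = 1"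
  shows "\<exists>B>0. \<forall>y. (\<forall>b\<in>I. 1 \<le> y b) \<and> (\<exists>a\<in>I. y a = 1) \<and> (\<forall>a\<in>I. Ph a y \<le> \<Lambda>) \<longrightarrow> (\<forall>b\<in>I. y b \<le> B)"
proof -
  define Q where "Q a b B \<longleftrightarrow>
    (\<forall>y. (\<forall>b\<in>I. 1 \<le> y b) \<and> y a = 1 \<and> (\<forall>a\<in>I. Ph a y \<le> \<Lambda>) \<longrightarrow> y b \<le> B)" for a b B
  have "\<exists>B. Q a b B" if a: "a \<in> I" and b: "b \<in> I" for a b
  proof (rule edges_connected[OF S a b, of "\<lambda>b. \<exists>B. Q a b B"])
    show "\<exists>B. Q a a B" by (intro exI[of _ 1]) (auto simp: Q_def)
  next
    fix b b' assume b: "b \<in> I" "(b, b') \<in> edges" "\<exists>B. Q a b B"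
    then obtain B where B: "Q a b B" by blast
    from edge_bound[OF b(2), of \<Lambda> B] obtain B' where
      B': "\<forall>y. (\<forall>b\<in>I. 1 \<le> y b) \<and> Ph b y \<le> \<Lambda> \<and> y b \<le> B \<longrightarrow> y b' \<le> B'" by blast
    then have "Q a b' B'" using B b(1) unfolding Q_def by blast
    then show "\<exists>B. Q a b' B" by blast
  qed
  then have "\<forall>ab\<in>I \<times> I. \<exists>B. Q (fst ab) (snd ab) B" by auto
  from bchoice[OF this] obtain B where "\<forall>ab\<in>I \<times> I. Q (fst ab) (snd ab) (B ab)" by blast
  then have B: "\<And>a b. a \<in> I \<Longrightarrow> b \<in> I \<Longrightarrow> Q a b (B (a, b))" by fastforce
  define B1 where "B1 = (\<Sum>ab\<in>I \<times> I. \<bar>B ab\<bar>) + 1"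
  have BB1: "B (a, b) \<le> B1" if "a \<in> I" "b \<in> I" for a b
  proof -
    have "\<bar>B (a, b)\<bar> \<le> (\<Sum>ab\<in>I \<times> I. \<bar>B ab\<bar>)"
      using finite_I that by (intro member_le_sum[of "(a, b)" _ "\<lambda>ab. \<bar>B ab\<bar>"]) auto
    then show ?thesis unfolding B1_def by linarith
  qed
  have "0 < B1" unfolding B1_def by (intro add_nonneg_pos sum_nonneg) auto
  moreover have "y b \<le> B1"
    if "\<forall>b\<in>I. 1 \<le> y b" "a \<in> I" "y a = 1" "\<forall>a\<in>I. Ph a y \<le> \<Lambda>" "b \<in> I" for y a b
  proof -
    have "y b \<le> B (a, b)"
      using B[OF that(2,5)] that unfolding Q_def by blast
    then show ?thesis using BB1[OF that(2,5)] by linarith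
  qed
  ultimately show ?thesis by (intro exI[of _ B1]) blast
qed

text \<open>
  Let \<open>exp (\<theta> z)\<close> be the largest such vector below \<open>x\<close>; the task is to bound \<open>\<theta>\<close> from below.  If
  \<open>S < 1\<close>, a coordinate where the two touch gives \<open>exp (\<theta> (S - 1)) Ph a 1 \<le> Ph a x \<le> \<Lambda>\<close>.  If
  \<open>S = 1\<close>, then \<open>Ph\<close> is invariant under the scaling, so the quotient of \<open>x\<close> by \<open>exp (\<theta> z)\<close> is bounded
  by connectedness, and some coordinate of \<open>x\<close> is not small because \<open>cc x = 1\<close>.
\<close>

lemma sublevel_lower_bound:
  "\<exists>\<theta>0. \<forall>x. pos x \<and> cc x = 1 \<and> (\<forall>a\<in>I. Ph a x \<le> \<Lambda>) \<longrightarrow> (\<forall>a\<in>I. exp (\<theta>0 * z a) \<le> x a)"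
proof (cases "S = 1")
  case False
  then have S: "S < 1" using S_le_1 by simp
  define \<kappa> where "\<kappa> = Min ((\<lambda>a. Ph a (\<lambda>_. 1)) ` I)"
  have pos1: "pos (\<lambda>_. 1)" by (simp add: pos_def)
  have \<kappa>: "0 < \<kappa>" unfolding \<kappa>_def using finite_I I_nonempty Ph_pos[OF pos1] by (subst Min_gr_iff) auto
  have "exp (ln (\<Lambda> / \<kappa>) / (S - 1) * z a) \<le> x a"
    if x: "pos x" and le: "\<forall>a\<in>I. Ph a x \<le> \<Lambda>" and a: "a \<in> I" for x a
  proof -
    from scaled_minimum[OF x] obtain \<theta> a0 where a0: "a0 \<in> I" "x a0 = exp (\<theta> * z a0)"
      and \<theta>: "\<And>b. b \<in> I \<Longrightarrow> exp (\<theta> * z b) \<le> x b" by blast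
    have "\<kappa> \<le> Ph a0 (\<lambda>_. 1)" unfolding \<kappa>_def using finite_I a0 by (intro Min_le) auto
    then have "exp (\<theta> * (S - 1)) * \<kappa> \<le> exp (\<theta> * (S - 1)) * Ph a0 (\<lambda>_. 1)" by simp
    also have "\<dots> = Ph a0 (\<lambda>b. exp (\<theta> * z b) * 1)"
      by (rule Ph_scale[OF pos1 a0(1), symmetric])
    also have "\<dots> \<le> Ph a0 x"
      using \<theta> a0 by (intro Ph_mono) (auto simp: pos_def)
    also have "\<dots> \<le> \<Lambda>" using le a0 by blast
    finally have "exp (\<theta> * (S - 1)) \<le> \<Lambda> / \<kappa>" using \<kappa> by (simp add: field_simps)
    then have "\<theta> * (S - 1) \<le> ln (\<Lambda> / \<kappa>)"
      by (smt (verit) exp_gt_zero exp_le_cancel_iff exp_ln)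
    then have "ln (\<Lambda> / \<kappa>) / (S - 1) \<le> \<theta>"
      using S by (simp add: neg_divide_le_eq)
    then have "ln (\<Lambda> / \<kappa>) / (S - 1) * z a \<le> \<theta> * z a"
      using z_pos[OF a] by (intro mult_right_mono) auto
    then have "exp (ln (\<Lambda> / \<kappa>) / (S - 1) * z a) \<le> exp (\<theta> * z a)" by simp
    then show ?thesis using \<theta>[OF a] by linarith
  qed
  then show ?thesis by blast
next
  case S: True
  from connected_bound[OF S, of \<Lambda>] obtain B where "B > 0" and
    B: "\<And>y b. (\<forall>b\<in>I. 1 \<le> y b) \<Longrightarrow> (\<exists>a\<in>I. y a = 1) \<Longrightarrow> (\<forall>a\<in>I. Ph a y \<le> \<Lambda>) \<Longrightarrow> b \<in> I \<Longrightarrow> y b \<le> B"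
    by blast
  \<comment> \<open>The constant vector \<open>t\<close> is normalised, so a normalised \<open>x\<close> has a coordinate at least \<open>t\<close>.\<close>
  define t where "t = 1 / root (card (blk ` I)) (cc (\<lambda>_. 1))"
  have pos1: "pos (\<lambda>_. 1)" by (simp add: pos_def)
  have t: "0 < t" unfolding t_def using root_cc_pos[OF pos1] by simp
  have cct: "cc (\<lambda>_. t) = 1" using cc_rn[OF pos1] by (simp add: rn_def t_def)
  define \<theta>0 where "\<theta>0 = Min ((\<lambda>b. p b * ln (t / B)) ` I)"
  have "exp (\<theta>0 * z a) \<le> x a"
    if x: "pos x" and c: "cc x = 1" and le: "\<forall>a\<in>I. Ph a x \<le> \<Lambda>" and a: "a \<in> I" for x a
  proof -
    from scaled_minimum[OF x] obtain \<theta> a0 where a0: "a0 \<in> I" "x a0 = exp (\<theta> * z a0)"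
      and \<theta>: "\<And>b. b \<in> I \<Longrightarrow> exp (\<theta> * z b) \<le> x b" by blast
    have "\<exists>b\<in>I. t \<le> x b"
    proof (rule ccontr)
      assume neg: "\<not> (\<exists>b\<in>I. t \<le> x b)"
      have "cc x < cc (\<lambda>_. t)"
        by (rule cc_strict_mono[OF x _ a]) (use neg a in force)+
      with c cct show False by simp
    qed
    then obtain b where b: "b \<in> I" "t \<le> x b" by blast
    define y where "y c = exp (- \<theta> * z c) * x c" for c
    have "y b \<le> B"
    proof (rule B)
      show "\<forall>c\<in>I. 1 \<le> y c"
        using \<theta> by (simp add: y_def exp_minus field_simps)
      show "\<exists>a\<in>I. y a = 1"
        using a0 by (intro bexI[of _ a0]) (simp_all add: y_def exp_minus)
      show "\<forall>a\<in>I. Ph a y \<le> \<Lambda>"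
        using Ph_scale[OF x, of _ "- \<theta>"] le S by (simp add: y_def[abs_def])
      show "b \<in> I" by (rule b)
    qed
    then have "t \<le> exp (\<theta> * z b) * B"
      using b(2) by (simp add: y_def exp_minus field_simps)
    then have "t / B \<le> exp (\<theta> * z b)" using \<open>B > 0\<close> by (simp add: field_simps)
    then have "ln (t / B) \<le> ln (exp (\<theta> * z b))"
      using t \<open>B > 0\<close> by (subst ln_le_cancel_iff) auto
    then have "ln (t / B) \<le> \<theta> * z b" by simp
    then have "p b * ln (t / B) \<le> \<theta>"
      using p_gt_0[OF b(1)] by (simp add: z_def field_simps)
    moreover have "\<theta>0 \<le> p b * ln (t / B)"
      unfolding \<theta>0_def using finite_I b by (intro Min_le) auto
    ultimately have "\<theta>0 * z a \<le> \<theta> * z a" using z_pos[OF a] by simp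
    then have "exp (\<theta>0 * z a) \<le> exp (\<theta> * z a)" by simp
    then show ?thesis using \<theta>[OF a] by linarith
  qed
  then show ?thesis by blast
qed

lemma sublevel_bounds:
  "\<exists>lo hi. 0 < lo \<and> (\<forall>x. pos x \<and> cc x = 1 \<and> (\<forall>a\<in>I. Ph a x \<le> \<Lambda>) \<longrightarrow> (\<forall>a\<in>I. lo \<le> x a \<and> x a \<le> hi))"
proof -
  from sublevel_lower_bound obtain \<theta>0 where
    \<theta>0: "\<And>x a. pos x \<Longrightarrow> cc x = 1 \<Longrightarrow> (\<forall>a\<in>I. Ph a x \<le> \<Lambda>) \<Longrightarrow> a \<in> I \<Longrightarrow> exp (\<theta>0 * z a) \<le> x a" by blast
  define lo where "lo = exp (- \<bar>\<theta>0\<bar>)"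
  have lo: "0 < lo" by (simp add: lo_def)
  have "lo \<le> x a \<and> x a \<le> 1 / lo ^ card (blk ` I - {blk a}) \<and>
      1 / lo ^ card (blk ` I - {blk a}) \<le> 1 / lo ^ card (blk ` I)"
    if x: "pos x" "cc x = 1" "\<forall>a\<in>I. Ph a x \<le> \<Lambda>" and a: "a \<in> I" for x a
  proof -
    have lower: "lo \<le> x b" if b: "b \<in> I" for b
    proof -
      have "\<bar>\<theta>0\<bar> * z b \<le> \<bar>\<theta>0\<bar> * 1" using z_less_1[OF b] by (intro mult_left_mono) auto
      moreover have "- (\<bar>\<theta>0\<bar> * z b) \<le> \<theta>0 * z b"
        using z_pos[OF b] by (simp add: abs_if mult_nonpos_nonneg)
      ultimately have "lo \<le> exp (\<theta>0 * z b)" unfolding lo_def by simp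
      then show ?thesis using \<theta>0[OF x b] by linarith
    qed
    have "lo ^ card (blk ` I - {blk a}) = (\<Prod>k\<in>blk ` I - {blk a}. lo)" by simp
    also have "\<dots> \<le> (\<Prod>k\<in>blk ` I - {blk a}. nrm k x)"
    proof (intro prod_mono conjI)
      fix k assume "k \<in> blk ` I - {blk a}"
      then obtain b where "b \<in> I" "k = blk b" by blast
      then show "lo \<le> nrm k x" using lower coord_le_nrm[OF x(1)] by (meson order_trans)
    qed (use lo in simp)
    finally have "x a * lo ^ card (blk ` I - {blk a}) \<le> nrm (blk a) x * (\<Prod>k\<in>blk ` I - {blk a}. nrm k x)"
      using coord_le_nrm[OF x(1) a] posD[OF x(1) a] lo
      by (intro mult_mono) auto
    also have "\<dots> = 1"
      using x(2) finite_I a prod.remove[of "blk ` I" "blk a" "\<lambda>k. nrm k x"] by (simp add: cc_def)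
    finally have "x a \<le> 1 / lo ^ card (blk ` I - {blk a})"
      using lo by (simp add: field_simps)
    moreover have "lo ^ card (blk ` I) \<le> lo ^ card (blk ` I - {blk a})"
      using lo finite_I by (intro power_decreasing card_mono) (auto simp: lo_def)
    then have "1 / lo ^ card (blk ` I - {blk a}) \<le> 1 / lo ^ card (blk ` I)"
      using lo by (intro divide_left_mono) auto
    ultimately show ?thesis using lower[OF a] by blast
  qed
  then have "\<forall>a\<in>I. lo \<le> x a \<and> x a \<le> 1 / lo ^ card (blk ` I)"
    if "pos x \<and> cc x = 1 \<and> (\<forall>a\<in>I. Ph a x \<le> \<Lambda>)" for x
    using that by (meson order_trans)
  then show ?thesis using lo by (intro exI[of _ lo] exI) blast
qed

subsection \<open>Continuity\<close>

context
  fixes X :: "nat \<Rightarrow> 'a \<Rightarrow> real" and x :: "'a \<Rightarrow> real"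
  assumes X: "\<And>b. b \<in> I \<Longrightarrow> (\<lambda>k. X k b) \<longlonglongrightarrow> x b"
begin

lemma F_tendsto: "a \<in> I \<Longrightarrow> (\<lambda>k. F a (X k)) \<longlonglongrightarrow> F a x"
  unfolding F_def mon_def using e_in_I X by (intro tendsto_intros) blast

lemma dF_tendsto:
  assumes "a \<in> I" "\<And>b. b \<in> I \<Longrightarrow> (\<lambda>k. V k b) \<longlonglongrightarrow> v b"
  shows "(\<lambda>k. dF a (X k) (V k)) \<longlonglongrightarrow> dF a x v"
  unfolding dF_def mon_def using e_in_I X assms by (intro tendsto_intros) blast+

lemma cc_tendsto: "(\<lambda>k. cc (X k)) \<longlonglongrightarrow> cc x"
  unfolding cc_def nrm_def
proof (intro tendsto_prod tendsto_powr2 tendsto_sum tendsto_const tendsto_rabs)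
  fix k assume k: "k \<in> blk ` I"
  then show "0 < q k" "0 < 1 / q k" using p_gt_0 by force+
qed (use X in \<open>auto simp: block_def sum_nonneg intro!: always_eventually\<close>)

context
  assumes x: "pos x"
begin

lemma Ph_tendsto: "a \<in> I \<Longrightarrow> (\<lambda>k. Ph a (X k)) \<longlonglongrightarrow> Ph a x"
  unfolding Ph_def using posD[OF x, of a]
  by (intro tendsto_divide F_tendsto tendsto_powr X tendsto_const) auto

lemma ph_tendsto: "(\<lambda>k. ph (X k)) \<longlonglongrightarrow> ph x"
  unfolding ph_def by (intro tendsto_Max_image finite_I I_nonempty Ph_tendsto)

lemma dPh_tendsto:
  assumes "a \<in> I" "\<And>b. b \<in> I \<Longrightarrow> (\<lambda>k. V k b) \<longlonglongrightarrow> v b"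
  shows "(\<lambda>k. dPh a (X k) (V k)) \<longlonglongrightarrow> dPh a x v"
  unfolding dPh_def using F_pos[OF x assms(1)] assms
  by (intro tendsto_mult tendsto_diff tendsto_divide Ph_tendsto F_tendsto dF_tendsto tendsto_const) auto

lemma W_tendsto:
  assumes "\<And>b. b \<in> I \<Longrightarrow> (\<lambda>k. V k b) \<longlonglongrightarrow> v b"
  shows "(\<lambda>k. W (X k) (V k)) \<longlonglongrightarrow> W x v"
  unfolding W_def w_def
proof (intro tendsto_sum tendsto_mult tendsto_divide tendsto_powr tendsto_const)
  fix a assume a: "a \<in> I"
  show "(\<Sum>b\<in>block (blk a). x b powr p b) \<noteq> 0" using block_pos[OF x a] by simp
  show "x a \<noteq> 0" using posD[OF x a] by simp
  fix b assume "b \<in> block (blk a)"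
  then have b: "b \<in> I" by (simp add: block_def)
  show "(\<lambda>k. X k b) \<longlonglongrightarrow> x b" by (rule X[OF b])
  show "x b \<noteq> 0" using posD[OF x b] by simp
qed (use X assms in auto)

lemma rn_tendsto: "b \<in> I \<Longrightarrow> (\<lambda>k. rn (X k) b) \<longlonglongrightarrow> rn x b"
  unfolding rn_def using root_cc_pos[OF x]
  by (intro tendsto_divide tendsto_real_root cc_tendsto X) auto

text \<open>Any row of the Newton system expresses \<open>\<delta>\<close> through \<open>x\<close> and \<open>v\<close>, so \<open>\<delta>\<close> converges with them.\<close>

lemma newton_limit:
  assumes V: "\<And>b. b \<in> I \<Longrightarrow> (\<lambda>k. V k b) \<longlonglongrightarrow> v b"
    and N: "\<And>k. newton (X k) (V k) (\<Delta> k)"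
  obtains \<delta> where "\<Delta> \<longlonglongrightarrow> \<delta>" "newton x v \<delta>"
proof -
  define D where "D a = dPh a x v - (ph x - Ph a x) * (v a + 1)" for a
  have lim: "\<Delta> \<longlonglongrightarrow> D a" if a: "a \<in> I" for a
  proof -
    have "(\<lambda>k. dPh a (X k) (V k) - (ph (X k) - Ph a (X k)) * (V k a + 1)) \<longlonglongrightarrow> D a"
      unfolding D_def using V a
      by (intro tendsto_intros dPh_tendsto ph_tendsto Ph_tendsto a) auto
    moreover have "dPh a (X k) (V k) - (ph (X k) - Ph a (X k)) * (V k a + 1) = \<Delta> k" for k
      using N[of k] a by (simp add: newton_def algebra_simps)
    ultimately show ?thesis by simp
  qed
  obtain a0 where a0: "a0 \<in> I" using I_nonempty by blast
  have "D a = D a0" if "a \<in> I" for a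
    using LIMSEQ_unique lim[OF that] lim[OF a0] by blast
  moreover have "W x v = 0"
    using W_tendsto[of V v, OF V] N by (simp add: newton_def LIMSEQ_const_iff)
  ultimately have "newton x v (D a0)"
    unfolding newton_def by (force simp: D_def)
  with lim[OF a0] that show thesis by blast
qed

end

end

text \<open>
  If Newton directions were unbounded, dividing them by their maximum norms \<open>t\<close> would give, along a subsequence, a
  limit of norm \<open>1\<close> that solves the homogeneous system at the limit point.
\<close>

lemma newton_bounded:
  assumes lo: "0 < lo"
  shows "\<exists>B. \<forall>x v \<delta>. (\<forall>a\<in>I. lo \<le> x a \<and> x a \<le> hi) \<and> newton x v \<delta> \<longrightarrow> (\<forall>a\<in>I. \<bar>v a\<bar> \<le> B)"
proof (rule ccontr)
  assume "\<not> ?thesis"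
  then have "\<exists>x v \<delta>. (\<forall>a\<in>I. lo \<le> x a \<and> x a \<le> hi) \<and> newton x v \<delta> \<and> \<not> (\<forall>a\<in>I. \<bar>v a\<bar> \<le> real k + 1)" for k
    by blast
  then obtain X V \<Delta> where XV: "\<And>k. (\<forall>a\<in>I. lo \<le> X k a \<and> X k a \<le> hi) \<and> newton (X k) (V k) (\<Delta> k)
      \<and> \<not> (\<forall>a\<in>I. \<bar>V k a\<bar> \<le> real k + 1)"
    by metis
  have X: "\<And>k a. a \<in> I \<Longrightarrow> lo \<le> X k a \<and> X k a \<le> hi"
    and N: "\<And>k. newton (X k) (V k) (\<Delta> k)" and big: "\<And>k::nat. \<exists>a\<in>I. real k + 1 < \<bar>V k a\<bar>"
    using XV by (auto simp: not_le)
  define t where "t k = Max ((\<lambda>a. \<bar>V k a\<bar>) ` I)" for k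
  define U where "U k a = V k a / t k" for k a
  have V_le: "\<bar>V k a\<bar> \<le> t k" if "a \<in> I" for k a
    unfolding t_def using finite_I that by (intro Max_ge) auto
  have t_gt: "real k + 1 < t k" for k
    using big[of k] V_le by (meson less_le_trans)
  have t_pos: "0 < t k" for k using t_gt[of k] by simp
  have U_le: "\<bar>U k a\<bar> \<le> 1" if "a \<in> I" for k a
    using V_le[OF that, of k] t_pos[of k] by (simp add: U_def)
  have "\<bar>X k a\<bar> \<le> hi" if "a \<in> I" for k a using X[OF that, of k] lo by simp
  from bounded_family_convergent_subseq[of I X, OF finite_I this] obtain f x where
    f: "strict_mono (f :: nat \<Rightarrow> nat)" and x: "\<forall>a\<in>I. (\<lambda>k. X (f k) a) \<longlonglongrightarrow> x a" by blast
  from bounded_family_convergent_subseq[of I "\<lambda>k. U (f k)", OF finite_I U_le] obtain g u where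
    g: "strict_mono (g :: nat \<Rightarrow> nat)" and u: "\<forall>a\<in>I. (\<lambda>k. U (f (g k)) a) \<longlonglongrightarrow> u a" by blast
  define h where "h k = f (g k)" for k
  have h: "strict_mono h" using strict_mono_o[OF f g] by (simp add: h_def[abs_def] o_def)
  have xh: "(\<lambda>k. X (h k) a) \<longlonglongrightarrow> x a" if "a \<in> I" for a
    using LIMSEQ_subseq_LIMSEQ[OF x[rule_format, OF that] g] by (simp add: h_def o_def)
  have uh: "(\<lambda>k. U (h k) a) \<longlonglongrightarrow> u a" if "a \<in> I" for a
    using u that by (simp add: h_def)
  have "lo \<le> x a" if "a \<in> I" for a
    using X[OF that] by (intro LIMSEQ_le_const[OF xh[OF that]]) auto
  then have pos: "pos x" using lo by (force simp: pos_def)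
  have "(\<lambda>k. inverse (t k)) \<longlonglongrightarrow> 0"
  proof (rule tendsto_sandwich[of "\<lambda>_. 0" _ _ "\<lambda>k. inverse (real (Suc k))"])
    show "\<forall>\<^sub>F k in sequentially. inverse (t k) \<le> inverse (real (Suc k))"
      using t_gt by (intro always_eventually allI le_imp_inverse_le) (auto intro: less_imp_le simp: add.commute)
  qed (use t_pos LIMSEQ_inverse_real_of_nat in \<open>auto intro!: always_eventually less_imp_le\<close>)
  from LIMSEQ_subseq_LIMSEQ[OF this h] have t0: "(\<lambda>k. inverse (t (h k))) \<longlonglongrightarrow> 0" by (simp add: o_def)
  define D where "D a = dPh a x u - (ph x - Ph a x) * u a" for a
  \<comment> \<open>Divided by \<open>t\<close>, the Newton equations lose their inhomogeneous part in the limit.\<close>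
  have lim: "(\<lambda>k. \<Delta> (h k) * inverse (t (h k))) \<longlonglongrightarrow> D a" if a: "a \<in> I" for a
  proof -
    have "(\<lambda>k. dPh a (X (h k)) (U (h k)) - (ph (X (h k)) - Ph a (X (h k))) * (U (h k) a + inverse (t (h k))))
        \<longlonglongrightarrow> dPh a x u - (ph x - Ph a x) * (u a + 0)"
      using a uh xh pos by (intro tendsto_intros dPh_tendsto ph_tendsto Ph_tendsto t0) auto
    moreover have "dPh a (X k) (U k) - (ph (X k) - Ph a (X k)) * (U k a + inverse (t k))
        = \<Delta> k * inverse (t k)" for k
    proof -
      have U: "U k = (\<lambda>b. inverse (t k) * V k b)" by (simp add: U_def fun_eq_iff divide_inverse)
      have row: "dPh a (X k) (V k) = (ph (X k) - Ph a (X k)) * (V k a + 1) + \<Delta> k"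
        using N[of k] a by (simp add: newton_def)
      show ?thesis unfolding U dPh_cmult row by (simp add: algebra_simps)
    qed
    ultimately show ?thesis by (simp add: D_def)
  qed
  obtain a0 where a0: "a0 \<in> I" using I_nonempty by blast
  have D: "D a = D a0" if "a \<in> I" for a
    using LIMSEQ_unique lim[OF that] lim[OF a0] by blast
  have "W (X k) (U k) = 0" for k
  proof -
    have "U k = (\<lambda>b. inverse (t k) * V k b)" by (simp add: U_def fun_eq_iff divide_inverse)
    then show ?thesis using N[of k] by (simp add: W_cmult newton_def)
  qed
  then have "W x u = 0"
    using W_tendsto[of "\<lambda>k. X (h k)" x "\<lambda>k. U (h k)" u, OF xh pos uh] by (simp add: LIMSEQ_const_iff)
  moreover have "(ph x - Ph a x) * u a + D a0 = dPh a x u" if "a \<in> I" for a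
    using D[OF that] unfolding D_def[of a] by simp
  ultimately have u0: "u a = 0" if "a \<in> I" for a
    using newton_matrix_injective[OF pos] that by blast
  have "(\<lambda>k. Max ((\<lambda>a. \<bar>U (h k) a\<bar>) ` I)) \<longlonglongrightarrow> Max ((\<lambda>a. \<bar>u a\<bar>) ` I)"
    by (intro tendsto_Max_image finite_I I_nonempty tendsto_rabs uh)
  moreover have "Max ((\<lambda>a. \<bar>u a\<bar>) ` I) = 0"
    using u0 I_nonempty by (simp cong: image_cong_simp add: image_constant_conv)
  moreover have "1 \<le> Max ((\<lambda>a. \<bar>U k a\<bar>) ` I)" for k
  proof -
    have "t k \<in> (\<lambda>a. \<bar>V k a\<bar>) ` I"
      unfolding t_def using finite_I I_nonempty by (intro Max_in) auto
    then obtain a where "a \<in> I" "\<bar>U k a\<bar> = 1" using t_pos[of k] by (auto simp: U_def)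
    then show ?thesis using finite_I by (metis (mono_tags, lifting) Max_ge finite_imageI image_eqI)
  qed
  ultimately have "1 \<le> (0::real)"
    by (intro LIMSEQ_le_const[of _ 0]) auto
  then show False by simp
qed

subsection \<open>The line search\<close>

definition along :: "('a \<Rightarrow> real) \<Rightarrow> ('a \<Rightarrow> real) \<Rightarrow> real \<Rightarrow> 'a \<Rightarrow> real" where
  "along x v t = (\<lambda>b. x b * (1 + t * v b))"

definition adm :: "real \<Rightarrow> ('a \<Rightarrow> real) \<Rightarrow> ('a \<Rightarrow> real) \<Rightarrow> real \<Rightarrow> real \<Rightarrow> bool" where
  "adm sg x v \<delta> \<alpha> \<longleftrightarrow> pos (along x v \<alpha>) \<and> ph (rn (along x v \<alpha>)) \<le> ph x + sg * \<alpha> * \<delta>"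

text \<open>
  The logarithmic velocity of the normalised point \<open>rn (along x v t)\<close>: normalising subtracts the mean growth of
  \<open>cc\<close>, which vanishes at \<open>t = 0\<close> for a tangent \<open>v\<close>.
\<close>

definition logvel :: "('a \<Rightarrow> real) \<Rightarrow> ('a \<Rightarrow> real) \<Rightarrow> real \<Rightarrow> 'a \<Rightarrow> real" where
  "logvel x v t = (\<lambda>b. v b / (1 + t * v b)
     + - (W (along x v t) (\<lambda>b. v b / (1 + t * v b)) / real (card (blk ` I))))"

lemma Ph_along_has_derivative:
  assumes x: "pos x" and t: "\<And>b. b \<in> I \<Longrightarrow> 0 < 1 + t * v b" and a: "a \<in> I"
  shows "((\<lambda>t. Ph a (rn (along x v t))) has_real_derivative
    dPh a (rn (along x v t)) (logvel x v t)) (at t)"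
proof -
  define N where "N = card (blk ` I)"
  define Y where "Y t = along x v t" for t
  define \<omega> where "\<omega> = W (Y t) (\<lambda>b. v b / (1 + t * v b))"
  have pY: "pos (Y t)" using posD[OF x] t by (simp add: Y_def along_def pos_def)
  have dY: "((\<lambda>t. Y t b) has_real_derivative x b * v b) (at t)" for b
    unfolding Y_def along_def by (auto intro!: derivative_eq_intros)
  have ratio: "x b * v b / Y t b = v b / (1 + t * v b)" if "b \<in> I" for b
    using posD[OF x that] by (simp add: Y_def along_def)
  have "W (Y t) (\<lambda>b. x b * v b / Y t b) = \<omega>"
    unfolding \<omega>_def W_def using ratio by (intro sum.cong) auto
  then have dc: "((\<lambda>t. cc (Y t)) has_real_derivative cc (Y t) * \<omega>) (at t)"
    using cc_has_derivative[OF dY pY] by simp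
  define \<rho> where "\<rho> = root N (cc (Y t))"
  have \<rho>: "0 < \<rho>" unfolding \<rho>_def N_def by (rule root_cc_pos[OF pY])
  have N: "0 < N" using card_blocks by (simp add: N_def)
  have cc\<rho>: "cc (Y t) = \<rho> ^ (N - 1) * \<rho>"
    unfolding power_minus_mult[OF N] \<rho>_def using cc_pos[OF pY] N by simp
  have "((\<lambda>t. root N (cc (Y t))) has_real_derivative
      inverse (real N * \<rho> ^ (N - Suc 0)) * (cc (Y t) * \<omega>)) (at t)"
    unfolding \<rho>_def by (rule DERIV_chain2[OF DERIV_real_root[OF N cc_pos[OF pY]] dc])
  also have "inverse (real N * \<rho> ^ (N - Suc 0)) * (cc (Y t) * \<omega>) = \<rho> * (\<omega> / N)"
    unfolding cc\<rho> using \<rho> N by (simp add: field_simps)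
  finally have d\<rho>: "((\<lambda>t. root N (cc (Y t))) has_real_derivative \<rho> * (\<omega> / N)) (at t)" .
  have dR: "((\<lambda>t. rn (Y t) b) has_real_derivative rn (Y t) b * logvel x v t b) (at t)" if "b \<in> I" for b
  proof -
    have nz: "root N (cc (Y t)) \<noteq> 0" using \<rho> by (simp add: \<rho>_def)
    have "((\<lambda>t. Y t b / root N (cc (Y t))) has_real_derivative
      (x b * v b * root N (cc (Y t)) - Y t b * (\<rho> * (\<omega> / N))) / (root N (cc (Y t)) * root N (cc (Y t)))) (at t)"
      by (rule DERIV_divide[OF dY d\<rho> nz])
    moreover have "(x b * v b * \<rho> - Y t b * (\<rho> * (\<omega> / N))) / (\<rho> * \<rho>)
        = Y t b / \<rho> * (x b * v b / Y t b + - (\<omega> / N))"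
      using \<rho> posD[OF pY that] by (simp add: field_simps)
    ultimately show ?thesis
      unfolding rn_def logvel_def N_def[symmetric] \<rho>_def[symmetric] ratio[OF that]
      by (simp add: \<omega>_def Y_def)
  qed
  have pR: "pos (rn (Y t))" by (rule pos_rn[OF pY])
  have "dPh a (rn (Y t)) (\<lambda>b. rn (Y t) b * logvel x v t b / rn (Y t) b) = dPh a (rn (Y t)) (logvel x v t)"
    using a posD[OF pR] by (intro dPh_cong) force+
  then show ?thesis
    using Ph_has_derivative[of "\<lambda>t. rn (Y t)", OF dR pR a] by (simp add: Y_def)
qed

text \<open>
  By the mean value theorem each component changes by \<open>\<beta> k\<close> times a derivative that tends to
  \<open>dPh a x v = (ph x - Ph a x) (v a + 1) + \<delta>\<close>.  For a component that is maximal at the limit this is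
  \<open>\<delta> < sg * \<delta>\<close>; the other components remain below \<open>ph\<close> for small steps.  Constant sequences give
  the success of a single line search, varying ones give its uniformity.
\<close>

lemma line_search_eventually_adm:
  assumes Xx: "\<And>b. b \<in> I \<Longrightarrow> (\<lambda>k. X k b) \<longlonglongrightarrow> x b" and Vv: "\<And>b. b \<in> I \<Longrightarrow> (\<lambda>k. V k b) \<longlonglongrightarrow> v b"
    and X: "\<And>k. pos (X k)" "\<And>k. cc (X k) = 1" and x: "pos x"
    and \<Delta>: "\<Delta> \<longlonglongrightarrow> \<delta>" and N: "newton x v \<delta>" and \<delta>: "\<delta> < 0" and sg: "sg < 1"
    and \<beta>: "\<And>k. 0 < \<beta> k" "\<beta> \<longlonglongrightarrow> 0"
  shows "\<forall>\<^sub>F k in sequentially. adm sg (X k) (V k) (\<Delta> k) (\<beta> k)"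
proof -
  define good where "good k \<longleftrightarrow> (\<forall>b\<in>I. \<bar>\<beta> k * V k b\<bar> < 1 / 2)" for k
  have "\<forall>\<^sub>F k in sequentially. \<bar>\<beta> k * V k b\<bar> < 1 / 2" if "b \<in> I" for b
  proof -
    have "(\<lambda>k. \<bar>\<beta> k * V k b\<bar>) \<longlonglongrightarrow> \<bar>0 * v b\<bar>" using that by (intro tendsto_intros \<beta> Vv)
    then show ?thesis by (rule order_tendstoD) simp
  qed
  then have ev_good: "\<forall>\<^sub>F k in sequentially. good k"
    unfolding good_def using finite_I by (intro eventually_ball_finite) auto
  have goodD: "0 < 1 + t * V k b" if "good k" "0 \<le> t" "t \<le> \<beta> k" "b \<in> I" for k t b
  proof -
    have "\<bar>t * V k b\<bar> \<le> \<bar>\<beta> k * V k b\<bar>"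
      using that(2,3) unfolding abs_mult by (intro mult_right_mono) auto
    then have "\<bar>t * V k b\<bar> < 1 / 2" using that unfolding good_def by force
    then show ?thesis by linarith
  qed
  have "cc x = 1" using cc_tendsto[of X x, OF Xx] X(2) by (simp add: LIMSEQ_const_iff)
  then have rx: "rn x = x" by (rule rn_id)
  have "\<forall>\<^sub>F k in sequentially. Ph a (rn (along (X k) (V k) (\<beta> k))) \<le> ph (X k) + sg * \<beta> k * \<Delta> k"
    if a: "a \<in> I" for a
  proof -
    define G where "G k t = dPh a (rn (along (X k) (V k) t)) (logvel (X k) (V k) t)" for k t
    have "\<exists>t. 0 \<le> t \<and> t \<le> \<beta> k \<and>
      (good k \<longrightarrow> Ph a (rn (along (X k) (V k) (\<beta> k))) = Ph a (X k) + \<beta> k * G k t)" for k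
    proof (cases "good k")
      case True
      have "\<exists>t. 0 < t \<and> t < \<beta> k \<and> Ph a (rn (along (X k) (V k) (\<beta> k))) - Ph a (rn (along (X k) (V k) 0))
          = (\<beta> k - 0) * G k t"
        unfolding G_def using goodD[OF True] \<beta>(1) a by (intro MVT2 Ph_along_has_derivative X(1)) auto
      moreover have "rn (along (X k) (V k) 0) = X k" using rn_id[OF X(2)] by (simp add: along_def)
      ultimately obtain t where "0 < t" "t < \<beta> k" "Ph a (rn (along (X k) (V k) (\<beta> k))) - Ph a (X k) = \<beta> k * G k t"
        by auto
      then show ?thesis by (intro exI[of _ t]) auto
    next
      case False
      then show ?thesis using \<beta>(1)[of k] by (intro exI[of _ 0]) auto
    qed
    then obtain \<xi> where \<xi>: "\<And>k. 0 \<le> \<xi> k" "\<And>k. \<xi> k \<le> \<beta> k"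
      and mvt: "\<And>k. good k \<Longrightarrow> Ph a (rn (along (X k) (V k) (\<beta> k))) = Ph a (X k) + \<beta> k * G k (\<xi> k)"
      by metis
    have \<xi>0: "\<xi> \<longlonglongrightarrow> 0"
      using \<xi> by (intro tendsto_sandwich[OF _ _ tendsto_const \<beta>(2)]) auto
    have Y: "(\<lambda>k. along (X k) (V k) (\<xi> k) b) \<longlonglongrightarrow> x b" if "b \<in> I" for b
    proof -
      have "(\<lambda>k. X k b * (1 + \<xi> k * V k b)) \<longlonglongrightarrow> x b * (1 + 0 * v b)"
        using that by (intro tendsto_intros Xx Vv \<xi>0)
      then show ?thesis by (simp add: along_def)
    qed
    have U: "(\<lambda>k. V k b / (1 + \<xi> k * V k b)) \<longlonglongrightarrow> v b" if "b \<in> I" for b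
    proof -
      have "(\<lambda>k. V k b / (1 + \<xi> k * V k b)) \<longlonglongrightarrow> v b / (1 + 0 * v b)"
        using that by (intro tendsto_intros Xx Vv \<xi>0) auto
      then show ?thesis by simp
    qed
    have L: "(\<lambda>k. logvel (X k) (V k) (\<xi> k) b) \<longlonglongrightarrow> v b" if "b \<in> I" for b
    proof -
      have "(\<lambda>k. logvel (X k) (V k) (\<xi> k) b) \<longlonglongrightarrow> v b + - (W x v / real (card (blk ` I)))"
        unfolding logvel_def using card_blocks
        by (intro tendsto_add tendsto_minus tendsto_divide tendsto_const U[OF that]
              W_tendsto[of "\<lambda>k. along (X k) (V k) (\<xi> k)" x, OF Y x U]) auto
      then show ?thesis using N by (simp add: newton_def)
    qed
    have R: "(\<lambda>k. rn (along (X k) (V k) (\<xi> k)) b) \<longlonglongrightarrow> x b" if "b \<in> I" for b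
      using rn_tendsto[of "\<lambda>k. along (X k) (V k) (\<xi> k)" x, OF Y x that] by (simp add: rx)
    from dPh_tendsto[of "\<lambda>k. rn (along (X k) (V k) (\<xi> k))" x a "\<lambda>k. logvel (X k) (V k) (\<xi> k)" v, OF R x a L]
    have "(\<lambda>k. G k (\<xi> k)) \<longlonglongrightarrow> dPh a x v" by (simp add: G_def)
    moreover have "dPh a x v = (ph x - Ph a x) * (v a + 1) + \<delta>" using N a by (simp add: newton_def)
    ultimately have G: "(\<lambda>k. G k (\<xi> k)) \<longlonglongrightarrow> (ph x - Ph a x) * (v a + 1) + \<delta>" by simp
    show ?thesis
    proof (cases "Ph a x = ph x")
      case True
      have "(\<lambda>k. G k (\<xi> k) - sg * \<Delta> k) \<longlonglongrightarrow> \<delta> - sg * \<delta>"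
        using G True by (intro tendsto_intros \<Delta>) simp
      moreover have "\<delta> - sg * \<delta> < 0"
        using mult_strict_right_mono_neg[OF sg \<delta>] by simp
      ultimately have "\<forall>\<^sub>F k in sequentially. G k (\<xi> k) - sg * \<Delta> k < 0" by (rule order_tendstoD)
      with ev_good show ?thesis
      proof eventually_elim
        case (elim k)
        then have "\<beta> k * G k (\<xi> k) \<le> \<beta> k * (sg * \<Delta> k)" using \<beta>(1)[of k] by simp
        then show ?case using mvt[OF elim(1)] Ph_le_ph[OF a, of "X k"] by (simp add: mult_ac)
      qed
    next
      case False
      have "(\<lambda>k. ph (X k) + sg * \<beta> k * \<Delta> k - (Ph a (X k) + \<beta> k * G k (\<xi> k)))
          \<longlonglongrightarrow> ph x + sg * 0 * \<delta> - (Ph a x + 0 * ((ph x - Ph a x) * (v a + 1) + \<delta>))"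
        by (intro tendsto_intros ph_tendsto[of X x, OF Xx x] Ph_tendsto[of X x a, OF Xx x a] \<beta> \<Delta> G)
      moreover have "0 < ph x + sg * 0 * \<delta> - (Ph a x + 0 * ((ph x - Ph a x) * (v a + 1) + \<delta>))"
        using False Ph_le_ph[OF a, of x] by simp
      ultimately have "\<forall>\<^sub>F k in sequentially. 0 < ph (X k) + sg * \<beta> k * \<Delta> k - (Ph a (X k) + \<beta> k * G k (\<xi> k))"
        by (rule order_tendstoD)
      with ev_good show ?thesis by eventually_elim (simp add: mvt)
    qed
  qed
  then have "\<forall>\<^sub>F k in sequentially. \<forall>a\<in>I. Ph a (rn (along (X k) (V k) (\<beta> k))) \<le> ph (X k) + sg * \<beta> k * \<Delta> k"
    using finite_I by (intro eventually_ball_finite) auto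
  with ev_good show ?thesis
  proof eventually_elim
    case (elim k)
    have "pos (along (X k) (V k) (\<beta> k))"
      using goodD[OF elim(1) less_imp_le[OF \<beta>(1)]] posD[OF X(1)] by (simp add: along_def pos_def)
    then show ?case unfolding adm_def using elim(2) by (blast intro: ph_le)
  qed
qed

subsection \<open>Convergence of the damped Newton iteration\<close>

definition run :: "real \<Rightarrow> real \<Rightarrow> (nat \<Rightarrow> 'a \<Rightarrow> real) \<Rightarrow> (nat \<Rightarrow> 'a \<Rightarrow> real) \<Rightarrow> (nat \<Rightarrow> real) \<Rightarrow>
    (nat \<Rightarrow> real) \<Rightarrow> bool" where
  "run sg rho X V \<Delta> \<alpha> \<longleftrightarrow> pos (X 0) \<and> cc (X 0) = 1 \<and> (\<forall>k.
     newton (X k) (V k) (\<Delta> k) \<and> (\<exists>i. \<alpha> k = rho ^ i) \<and> adm sg (X k) (V k) (\<Delta> k) (\<alpha> k) \<and>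
     (\<forall>i. adm sg (X k) (V k) (\<Delta> k) (rho ^ i) \<longrightarrow> rho ^ i \<le> \<alpha> k) \<and>
     (\<forall>b\<in>I. X (Suc k) b = rn (along (X k) (V k) (\<alpha> k)) b))"

definition solution :: "('a \<Rightarrow> real) \<Rightarrow> bool" where
  "solution x \<longleftrightarrow> pos x \<and> cc x = 1 \<and> (\<forall>a\<in>I. Ph a x = ph x)"

lemma solution_unique: "solution x \<Longrightarrow> solution y \<Longrightarrow> a \<in> I \<Longrightarrow> x a = y a"
  using constant_Ph_unique[of x y "ph x" "ph y" a] by (simp add: solution_def)

context
  fixes sg rho :: real and X V \<Delta> \<alpha>
  assumes sg: "0 < sg" "sg < 1" and rho: "0 < rho" "rho < 1" and run: "run sg rho X V \<Delta> \<alpha>"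
begin

lemma run_newton: "newton (X k) (V k) (\<Delta> k)"
  using run by (simp add: run_def)

lemma run_adm: "adm sg (X k) (V k) (\<Delta> k) (\<alpha> k)"
  using run by (simp add: run_def)

lemma run_Suc: "b \<in> I \<Longrightarrow> X (Suc k) b = rn (along (X k) (V k) (\<alpha> k)) b"
  using run by (simp add: run_def)

lemma run_feasible: "pos (X k) \<and> cc (X k) = 1"
proof (induction k)
  case 0
  show ?case using run by (simp add: run_def)
next
  case (Suc k)
  have "pos (along (X k) (V k) (\<alpha> k))" using run_adm[of k] by (simp add: adm_def)
  from pos_rn[OF this] cc_rn[OF this] show ?case
    using pos_cong[of "X (Suc k)", OF run_Suc] cc_cong[of "X (Suc k)", OF run_Suc] by simp
qed

lemma run_step_pos: "0 < \<alpha> k"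
  using run rho unfolding run_def by (metis zero_less_power)

lemma run_\<Delta>_nonpos: "\<Delta> k \<le> 0"
  using newton_decrease_nonpos[OF _ run_newton] run_feasible by blast

lemma run_descent: "ph (X (Suc k)) \<le> ph (X k) + sg * (\<alpha> k * \<Delta> k)"
  using run_adm[of k] ph_cong[of "X (Suc k)", OF run_Suc] by (simp add: adm_def mult_ac)

lemma run_decseq: "decseq (\<lambda>k. ph (X k))"
proof (rule decseq_SucI)
  fix k
  have "sg * (\<alpha> k * \<Delta> k) \<le> 0"
    using sg run_step_pos[of k] run_\<Delta>_nonpos[of k] by (simp add: mult_nonneg_nonpos)
  then show "ph (X (Suc k)) \<le> ph (X k)" using run_descent[of k] by linarith
qed

text \<open>
  The total decrease of \<open>ph\<close> is finite, and each step decreases it by at least \<open>sg\<close> times \<open>- \<alpha> k * \<Delta> k\<close>.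
\<close>

lemma run_\<alpha>\<Delta>: "(\<lambda>k. \<alpha> k * \<Delta> k) \<longlonglongrightarrow> 0"
proof -
  have "\<forall>k. 0 \<le> ph (X k)" using ph_pos run_feasible by (meson less_imp_le)
  from decseq_convergent[OF run_decseq this] obtain l where l: "(\<lambda>k. ph (X k)) \<longlonglongrightarrow> l" by blast
  have "(\<lambda>k. (ph (X (Suc k)) - ph (X k)) / sg) \<longlonglongrightarrow> (l - l) / sg"
    using sg by (intro tendsto_intros l LIMSEQ_Suc[OF l]) auto
  then have lower: "(\<lambda>k. (ph (X (Suc k)) - ph (X k)) / sg) \<longlonglongrightarrow> 0" by simp
  show ?thesis
  proof (rule tendsto_sandwich[OF _ _ lower tendsto_const])
    show "\<forall>\<^sub>F k in sequentially. (ph (X (Suc k)) - ph (X k)) / sg \<le> \<alpha> k * \<Delta> k"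
      using run_descent sg by (intro always_eventually allI) (simp add: pos_divide_le_eq algebra_simps)
    show "\<forall>\<^sub>F k in sequentially. \<alpha> k * \<Delta> k \<le> 0"
      using run_step_pos run_\<Delta>_nonpos
      by (intro always_eventually allI mult_nonneg_nonpos) (auto intro: less_imp_le)
  qed
qed

text \<open>
  Pass to a subsequence on which points, directions and slopes converge.  A negative limit slope would force
  \<open>\<alpha> k\<close> to tend to \<open>0\<close>; then the next larger trial step \<open>\<alpha> k / rho\<close> also tends to \<open>0\<close> and is
  eventually admissible, against the maximality of \<open>\<alpha> k\<close>.
\<close>

lemma run_cluster_point:
  assumes f: "strict_mono (f :: nat \<Rightarrow> nat)"
  obtains g x where "strict_mono (g :: nat \<Rightarrow> nat)" "solution x"
    "\<And>b. b \<in> I \<Longrightarrow> (\<lambda>k. X (f (g k)) b) \<longlonglongrightarrow> x b"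
proof -
  from sublevel_bounds[of "ph (X 0)"] obtain lo hi where lo: "0 < lo"
    and bounds: "\<And>x. pos x \<and> cc x = 1 \<and> (\<forall>a\<in>I. Ph a x \<le> ph (X 0)) \<Longrightarrow> \<forall>a\<in>I. lo \<le> x a \<and> x a \<le> hi"
    by blast
  have "Ph a (X k) \<le> ph (X 0)" if "a \<in> I" for a k
    using Ph_le_ph[OF that, of "X k"] decseqD[OF run_decseq, of 0 k] by simp
  then have Xb: "\<forall>a\<in>I. lo \<le> X k a \<and> X k a \<le> hi" for k
    using run_feasible[of k] by (intro bounds) blast
  from newton_bounded[OF lo, of hi] obtain B where
    B: "\<And>x v \<delta>. (\<forall>a\<in>I. lo \<le> x a \<and> x a \<le> hi) \<Longrightarrow> newton x v \<delta> \<Longrightarrow> \<forall>a\<in>I. \<bar>v a\<bar> \<le> B" by blast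
  have Vb: "\<bar>V k a\<bar> \<le> B" if "a \<in> I" for k a using B[OF Xb run_newton] that by blast
  have Xb': "\<bar>X k a\<bar> \<le> hi" if "a \<in> I" for k a using Xb[of k] lo that by fastforce
  from bounded_family_convergent_subseq[of I "\<lambda>k. X (f k)", OF finite_I Xb'] obtain g1 x where
    g1: "strict_mono (g1 :: nat \<Rightarrow> nat)" and x: "\<forall>a\<in>I. (\<lambda>k. X (f (g1 k)) a) \<longlonglongrightarrow> x a" by blast
  from bounded_family_convergent_subseq[of I "\<lambda>k. V (f (g1 k))", OF finite_I Vb] obtain g2 v where
    g2: "strict_mono (g2 :: nat \<Rightarrow> nat)" and v: "\<forall>a\<in>I. (\<lambda>k. V (f (g1 (g2 k))) a) \<longlonglongrightarrow> v a" by blast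
  define h where "h k = f (g1 (g2 k))" for k
  have g: "strict_mono (\<lambda>k. g1 (g2 k))" using strict_mono_o[OF g1 g2] by (simp add: o_def)
  have h: "strict_mono h" using strict_mono_o[OF f g] by (simp add: h_def[abs_def] o_def)
  have xh: "(\<lambda>k. X (h k) a) \<longlonglongrightarrow> x a" if "a \<in> I" for a
    using LIMSEQ_subseq_LIMSEQ[OF x[rule_format, OF that] g2] by (simp add: h_def o_def)
  have vh: "(\<lambda>k. V (h k) a) \<longlonglongrightarrow> v a" if "a \<in> I" for a
    using v that by (simp add: h_def)
  have "lo \<le> x a" if "a \<in> I" for a
    using Xb that by (intro LIMSEQ_le_const[OF xh[OF that]]) auto
  then have pos: "pos x" using lo by (force simp: pos_def)
  have cx: "cc x = 1"
    using cc_tendsto[of "\<lambda>k. X (h k)" x, OF xh] run_feasible by (simp add: LIMSEQ_const_iff)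
  from newton_limit[of "\<lambda>k. X (h k)" x "\<lambda>k. V (h k)" v "\<lambda>k. \<Delta> (h k)", OF xh pos vh run_newton]
  obtain \<delta> where \<delta>: "(\<lambda>k. \<Delta> (h k)) \<longlonglongrightarrow> \<delta>" and N: "newton x v \<delta>" by blast
  have "\<not> \<delta> < 0"
  proof
    assume neg: "\<delta> < 0"
    have prod0: "(\<lambda>k. \<alpha> (h k) * \<Delta> (h k)) \<longlonglongrightarrow> 0"
      using LIMSEQ_subseq_LIMSEQ[OF run_\<alpha>\<Delta> h] by (simp add: o_def)
    have "\<forall>\<^sub>F k in sequentially. \<Delta> (h k) < 0" by (rule order_tendstoD(2)[OF \<delta> neg])
    then have "\<forall>\<^sub>F k in sequentially. \<alpha> (h k) * \<Delta> (h k) / \<Delta> (h k) = \<alpha> (h k)"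
      by eventually_elim simp
    moreover have "(\<lambda>k. \<alpha> (h k) * \<Delta> (h k) / \<Delta> (h k)) \<longlonglongrightarrow> 0 / \<delta>"
      using neg by (intro tendsto_divide prod0 \<delta>) simp
    ultimately have \<alpha>0: "(\<lambda>k. \<alpha> (h k)) \<longlonglongrightarrow> 0"
      using tendsto_cong[of "\<lambda>k. \<alpha> (h k) * \<Delta> (h k) / \<Delta> (h k)" "\<lambda>k. \<alpha> (h k)"] by simp
    then have "(\<lambda>k. \<alpha> (h k) / rho) \<longlonglongrightarrow> 0 / rho" using rho by (intro tendsto_divide tendsto_const) auto
    then have \<beta>: "(\<lambda>k. \<alpha> (h k) / rho) \<longlonglongrightarrow> 0" by simp
    have "\<forall>\<^sub>F k in sequentially. adm sg (X (h k)) (V (h k)) (\<Delta> (h k)) (\<alpha> (h k) / rho)"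
      using run_feasible run_step_pos rho
      by (intro line_search_eventually_adm[of "\<lambda>k. X (h k)" x "\<lambda>k. V (h k)" v "\<lambda>k. \<Delta> (h k)" \<delta>]
          xh vh pos \<delta> N neg sg \<beta>) auto
    moreover have "\<forall>\<^sub>F k in sequentially. \<alpha> (h k) < 1" by (rule order_tendstoD(2)[OF \<alpha>0]) simp
    ultimately have "\<forall>\<^sub>F k in sequentially. False"
    proof eventually_elim
      case (elim k)
      obtain i where i: "\<alpha> (h k) = rho ^ i" using run unfolding run_def by blast
      then obtain j where "i = Suc j" using elim(2) by (cases i) auto
      then have j: "\<alpha> (h k) / rho = rho ^ j" using i rho by simp
      then have "\<alpha> (h k) / rho \<le> \<alpha> (h k)" using run elim(1) by (simp add: run_def)
      then show False using run_step_pos[of "h k"] rho by (simp add: field_simps)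
    qed
    then show False by simp
  qed
  then have "\<forall>a\<in>I. Ph a x = ph x" using newton_decrease_nonneg[OF pos N] by simp
  then have "solution x" using pos cx by (simp add: solution_def)
  moreover have "(\<lambda>k. X (f (g1 (g2 k))) b) \<longlonglongrightarrow> x b" if "b \<in> I" for b
    using xh[OF that] by (simp add: h_def)
  ultimately show thesis using that g by blast
qed

lemma run_converges:
  obtains x where "solution x" "\<And>b. b \<in> I \<Longrightarrow> (\<lambda>k. X k b) \<longlonglongrightarrow> x b" "(\<lambda>k. ph (X k)) \<longlonglongrightarrow> ph x"
proof -
  have "strict_mono (id :: nat \<Rightarrow> nat)" by (simp add: strict_mono_def)
  from run_cluster_point[OF this] obtain x where x: "solution x" by blast
  have lim: "(\<lambda>k. X k b) \<longlonglongrightarrow> x b" if b: "b \<in> I" for b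
  proof (rule tendsto_if_subsubseq)
    fix f :: "nat \<Rightarrow> nat" assume f: "strict_mono f"
    obtain g y where "strict_mono (g :: nat \<Rightarrow> nat)" "solution y"
      "\<And>b. b \<in> I \<Longrightarrow> (\<lambda>k. X (f (g k)) b) \<longlonglongrightarrow> y b"
      using run_cluster_point[OF f] by blast
    then show "\<exists>g. strict_mono (g :: nat \<Rightarrow> nat) \<and> (\<lambda>k. X (f (g k)) b) \<longlonglongrightarrow> x b"
      using solution_unique[OF x] b by auto
  qed
  have "(\<lambda>k. ph (X k)) \<longlonglongrightarrow> ph x"
    using x by (intro ph_tendsto lim) (auto simp: solution_def)
  with x lim that show thesis by blast
qed

end

lemma step_exists:
  assumes sg: "sg < 1" and rho: "0 < rho" "rho < 1"
    and x: "pos x" "cc x = 1" and N: "newton x v \<delta>" and \<delta>: "\<delta> < 0"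
  obtains i where "adm sg x v \<delta> (rho ^ i)" "\<And>j. adm sg x v \<delta> (rho ^ j) \<Longrightarrow> rho ^ j \<le> rho ^ i"
proof -
  have "\<forall>\<^sub>F k in sequentially. adm sg x v \<delta> (rho ^ k)"
    using rho x N \<delta> sg
    by (intro line_search_eventually_adm[of "\<lambda>_. x" x "\<lambda>_. v" v "\<lambda>_. \<delta>" \<delta>]) (auto intro: LIMSEQ_realpow_zero)
  then have ex: "\<exists>i. adm sg x v \<delta> (rho ^ i)" by (rule eventually_happens'[OF sequentially_bot])
  define i where "i = (LEAST i. adm sg x v \<delta> (rho ^ i))"
  have "adm sg x v \<delta> (rho ^ i)" unfolding i_def using ex by (rule LeastI_ex)
  moreover have "rho ^ j \<le> rho ^ i" if "adm sg x v \<delta> (rho ^ j)" for j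
    using that rho unfolding i_def by (intro power_decreasing Least_le) auto
  ultimately show thesis using that by blast
qed

end

section \<open>The tensor as a posynomial system\<close>

locale ls_nnm_data = tensor_data m N A d \<sigma> p
  for m :: nat and N :: "nat \<Rightarrow> nat" and A :: "(nat \<Rightarrow> nat) \<Rightarrow> real"
    and d :: nat and \<sigma> :: "nat \<Rightarrow> nat set" and p :: "nat \<Rightarrow> real" +
  assumes nonneg: "nonneg_tensor m N A"
    and shape: "shape_partition m N d \<sigma>"
    and p_gt_1: "i \<in> {1..d} \<Longrightarrow> 1 < p i"
    and alternatives: "strictly_nonnegative \<and> (\<Sum>i\<in>{1..d}. real (card (\<sigma> i)) / p i) < 1
       \<or> weakly_irreducible \<and> (\<Sum>i\<in>{1..d}. real (card (\<sigma> i)) / p i) = 1"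
begin

definition block_of :: "nat \<Rightarrow> nat" where "block_of l = (THE i. i \<in> {1..d} \<and> l \<in> \<sigma> i)"

text \<open>
  Points as families indexed by the pairs in \<open>idx\<close>, the index set of the posynomial system.
\<close>

definition flat :: "(nat \<Rightarrow> nat \<Rightarrow> real) \<Rightarrow> nat \<times> nat \<Rightarrow> real" where
  "flat x a = x (fst a) (snd a)"

lemma flat_Pair [simp]: "flat x (i, j) = x i j"
  by (simp add: flat_def)

lemma partition: "partition_on {1..m} (\<sigma> ` {1..d})" "inj_on \<sigma> {1..d}"
  using shape unfolding shape_partition_def by blast+

lemma N_const:
  assumes "i \<in> {1..d}" "j \<in> \<sigma> i" "j' \<in> \<sigma> i"
  shows "N j = N j'"
proof -
  have "\<forall>i\<in>{1..d}. \<forall>j\<in>\<sigma> i. \<forall>j'\<in>\<sigma> i. N j = N j'"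
    using shape unfolding shape_partition_def by (elim conjE)
  with assms show ?thesis by (elim ballE) auto
qed

lemma union_blocks: "(\<Union>i\<in>{1..d}. \<sigma> i) = {1..m}"
  using partition_onD1[OF partition(1)] by simp

lemma blocks_disjoint: "i \<in> {1..d} \<Longrightarrow> j \<in> {1..d} \<Longrightarrow> l \<in> \<sigma> i \<Longrightarrow> l \<in> \<sigma> j \<Longrightarrow> i = j"
proof -
  assume ij: "i \<in> {1..d}" "j \<in> {1..d}" "l \<in> \<sigma> i" "l \<in> \<sigma> j"
  have "\<sigma> i = \<sigma> j"
    using disjointD[OF partition_onD2[OF partition(1)], of "\<sigma> i" "\<sigma> j"] ij by blast
  from inj_onD[OF partition(2) this ij(1,2)] show "i = j" .
qed

lemma block_nonempty: "i \<in> {1..d} \<Longrightarrow> \<sigma> i \<noteq> {}"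
  using partition_onD3[OF partition(1)] by force

lemma finite_sigma: "i \<in> {1..d} \<Longrightarrow> finite (\<sigma> i)"
  using union_blocks by (intro finite_subset[of "\<sigma> i" "{1..m}"]) blast+

lemma block_of_eq: "i \<in> {1..d} \<Longrightarrow> l \<in> \<sigma> i \<Longrightarrow> block_of l = i"
  unfolding block_of_def by (rule the_equality) (use blocks_disjoint in blast)+

lemma block_of: "l \<in> {1..m} \<Longrightarrow> block_of l \<in> {1..d} \<and> l \<in> \<sigma> (block_of l)"
  using union_blocks block_of_eq by blast

lemma s_in_block: "i \<in> {1..d} \<Longrightarrow> s i \<in> \<sigma> i"
  unfolding s_def using finite_sigma block_nonempty by (intro Min_in) auto

lemma s_in: "i \<in> {1..d} \<Longrightarrow> s i \<in> {1..m}"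
  using s_in_block union_blocks by blast

lemma block_of_s: "i \<in> {1..d} \<Longrightarrow> block_of (s i) = i"
  using block_of_eq s_in_block by blast

lemma N_eq_n: "l \<in> {1..m} \<Longrightarrow> N l = n (block_of l)"
  unfolding n_def using block_of[of l] s_in_block[of "block_of l"] N_const by blast

lemma n_ge_1: "i \<in> {1..d} \<Longrightarrow> 1 \<le> n i"
  using nonneg s_in[of i] by (auto simp: nonneg_tensor_def n_def)

lemma d_ge_1: "1 \<le> d"
proof -
  have "1 \<in> {1..m}" using nonneg by (auto simp: nonneg_tensor_def)
  from block_of[OF this] show ?thesis by auto
qed

lemma in_idx: "a \<in> idx \<longleftrightarrow> fst a \<in> {1..d} \<and> snd a \<in> {1..n (fst a)}"
  by (cases a) (simp add: idx_def)

lemma finite_idx: "finite idx"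
  by (simp add: idx_def)

lemma fst_idx: "fst ` idx = {1..d}"
proof (rule antisym; rule subsetI)
  fix i assume "i \<in> {1..d}"
  then have "(i, 1) \<in> idx" using n_ge_1 by (simp add: idx_def)
  then show "i \<in> fst ` idx" by force
qed (auto simp: idx_def)

lemma finite_multi_index: "finite (multi_index m N)"
  unfolding multi_index_def by (intro finite_PiE) auto

lemma entry_in_idx:
  assumes "J \<in> multi_index m N" "l \<in> {1..m}"
  shows "(block_of l, J l) \<in> idx"
proof -
  have "J l \<in> {1..N l}" using assms by (auto simp: multi_index_def)
  then show ?thesis using N_eq_n block_of assms by (auto simp: in_idx)
qed

lemma rep_eq: "rep x l t = x (block_of l) t"
  by (simp add: rep_def block_of_def)

definition terms :: "nat \<times> nat \<Rightarrow> (nat \<Rightarrow> nat) set" where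
  "terms a = {J. J \<in> multi_index m N \<and> J (s (fst a)) = snd a}"

text \<open>
  Row \<open>(i, t)\<close> of the system is \<open>scrA (s i) t\<close>: its terms are the multi-indices \<open>J\<close> with \<open>J (s i) = t\<close>,
  and the factor at position \<open>l\<close> is the coordinate \<open>J l\<close> of the block containing \<open>l\<close>.
\<close>

definition others :: "nat \<times> nat \<Rightarrow> nat set" where
  "others a = {1..m} - {s (fst a)}"

definition cell :: "(nat \<Rightarrow> nat) \<Rightarrow> nat \<Rightarrow> nat \<times> nat" where
  "cell J l = (block_of l, J l)"

definition weight_sum :: real where
  "weight_sum = (\<Sum>i\<in>{1..d}. real (card (\<sigma> i)) / p i)"

text \<open>
  A nonzero entry of \<open>M\<close> comes from a positive tensor entry whose monomial contains the variable:
  otherwise the differentiated function is constant.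
\<close>

lemma M_nonzero_edge:
  assumes "M a b \<noteq> 0"
  shows "\<exists>J\<in>terms a. 0 < A J \<and> b \<in> cell J ` others a"
proof (rule ccontr)
  assume neg: "\<not> ?thesis"
  have const: "A J * (\<Prod>l\<in>others a. rep (upd (\<lambda>_ _. 1) b u) l (J l)) = A J"
    if J: "J \<in> terms a" for J u
  proof (cases "A J = 0")
    case False
    moreover have "0 \<le> A J" using J nonneg by (auto simp: terms_def nonneg_tensor_def)
    ultimately have "b \<notin> cell J ` others a" using neg J by force
    then have "(\<Prod>l\<in>others a. rep (upd (\<lambda>_ _. 1) b u) l (J l)) = 1"
    proof (intro prod.neutral ballI)
      fix l assume "l \<in> others a"
      with \<open>b \<notin> _\<close> have "(block_of l, J l) \<noteq> b" by (auto simp: cell_def)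
      then show "rep (upd (\<lambda>_ _. 1) b u) l (J l) = 1" by (auto simp: rep_eq upd_def)
    qed
    then show ?thesis by simp
  qed simp
  have "(\<lambda>u. scrA (s (fst a)) (snd a) (rep (upd (\<lambda>_ _. 1) b u))) = (\<lambda>u. \<Sum>J\<in>terms a. A J)"
    unfolding scrA_def terms_def[symmetric] others_def[symmetric] by (intro ext sum.cong refl const)
  then have "M a b = 0" unfolding M_def by simp
  with assms show False by simp
qed

lemma idx_edge: "a \<in> idx \<Longrightarrow> \<exists>b\<in>idx. M a b \<noteq> 0"
  using alternatives
proof
  assume "a \<in> idx" "weakly_irreducible \<and> (\<Sum>i\<in>{1..d}. real (card (\<sigma> i)) / p i) = 1"
  then have "(a, a) \<in> {(a, b). a \<in> idx \<and> b \<in> idx \<and> M a b \<noteq> 0}\<^sup>+"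
    by (auto simp: weakly_irreducible_def)
  then show ?thesis by (auto dest!: tranclD)
qed (auto simp: strictly_nonnegative_def)

lemma sum_over_blocks: "(\<Sum>l\<in>{1..m}. f (block_of l)) = (\<Sum>i\<in>{1..d}. real (card (\<sigma> i)) * f i)"
proof -
  have "(\<Sum>l\<in>{1..m}. f (block_of l)) = (\<Sum>i\<in>{1..d}. \<Sum>l\<in>\<sigma> i. f (block_of l))"
    unfolding union_blocks[symmetric]
    using finite_sigma blocks_disjoint by (intro sum.UNION_disjoint) auto
  also have "\<dots> = (\<Sum>i\<in>{1..d}. \<Sum>l\<in>\<sigma> i. f i)"
    by (intro sum.cong refl) (simp add: block_of_eq)
  finally show ?thesis by simp
qed

sublocale ps: posynomial_system idx terms A others cell fst p weight_sum
proof
  show "finite idx" by (rule finite_idx)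
  show "idx \<noteq> {}" using fst_idx d_ge_1 by force
  show "weight_sum \<le> 1" unfolding weight_sum_def using alternatives by linarith
next
  fix a assume a: "a \<in> idx"
  then have i: "fst a \<in> {1..d}" by (simp add: in_idx)
  show "finite (terms a)"
    using finite_multi_index by (simp add: terms_def)
  show "finite (others a)" by (simp add: others_def)
  show "1 < p (fst a)" using p_gt_1 i by blast
  show "\<exists>J\<in>terms a. 0 < A J"
    using idx_edge[OF a] M_nonzero_edge by blast
  fix J assume J: "J \<in> terms a"
  show "0 \<le> A J" using J nonneg by (auto simp: terms_def nonneg_tensor_def)
  show "(\<Sum>l\<in>others a. 1 / p (fst (cell J l))) = weight_sum - 1 / p (fst a)"
    using sum_over_blocks[of "\<lambda>i. 1 / p i"] s_in[OF i] block_of_s[OF i]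
    by (simp add: others_def cell_def weight_sum_def sum_diff1)
  fix l assume "l \<in> others a"
  then show "cell J l \<in> idx"
    unfolding cell_def using J by (intro entry_in_idx) (auto simp: terms_def others_def)
next
  fix a b assume "weight_sum = 1" and ab: "a \<in> idx" "b \<in> idx"
  then have "(a, b) \<in> {(a, b). a \<in> idx \<and> b \<in> idx \<and> M a b \<noteq> 0}\<^sup>+"
    using alternatives unfolding weight_sum_def by (auto simp: weakly_irreducible_def)
  then show "(a, b) \<in> {(a, b). a \<in> idx \<and> (\<exists>J\<in>terms a. 0 < A J \<and> b \<in> cell J ` others a)}\<^sup>+"
    by (rule trancl_mono) (use M_nonzero_edge in auto)
qed

lemma scrA_eq: "scrA (s i) t (rep x) = ps.F (i, t) (flat x)"
  unfolding scrA_def ps.F_def ps.mon_def terms_def others_def by (simp add: rep_eq cell_def)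

lemma Phi_eq: "Phi x i j = ps.Ph (i, j) (flat x)"
  by (simp add: Phi_def ps.Ph_def scrA_eq)

lemma phi_eq: "phi x = ps.ph (flat x)"
  unfolding phi_def ps.ph_def by (intro arg_cong[of _ _ Max] image_cong) (auto simp: Phi_eq)

lemma block_eq: "i \<in> {1..d} \<Longrightarrow> ps.block i = Pair i ` {1..n i}"
  by (auto simp: ps.block_def in_idx)

lemma nrm_eq: "i \<in> {1..d} \<Longrightarrow> ps.nrm i (flat x) = lp_norm (n i) (p i) (x i)"
  unfolding ps.nrm_def lp_norm_def block_eq by (subst sum.reindex) (auto simp: inj_on_def)

lemma c_eq: "c x = ps.cc (flat x)"
  unfolding c_def ps.cc_def fst_idx by (simp add: nrm_eq)

lemma R_eq: "R x i j = ps.rn (flat x) (i, j)"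
  unfolding R_def ps.rn_def fst_idx c_eq by simp

lemma flat_R: "flat (R x) = ps.rn (flat x)"
  by (rule ext) (simp add: flat_def R_eq)

lemma Rsigma_pos_pos: "x \<in> Rsigma_pos \<Longrightarrow> ps.pos (flat x)"
  by (auto simp: Rsigma_pos_def ps.pos_def flat_def)

lemma C_iff: "x \<in> C \<longleftrightarrow> x \<in> Rsigma \<and> ps.pos (flat x) \<and> ps.cc (flat x) = 1"
  by (auto simp: C_def Rsigma_pos_def ps.pos_def flat_def c_eq)

lemma R_in_C:
  assumes "x \<in> Rsigma_pos"
  shows "R x \<in> C"
proof -
  have "R x \<in> Rsigma" using assms by (auto simp: Rsigma_pos_def Rsigma_def R_def)
  then show ?thesis
    using ps.pos_rn ps.cc_rn Rsigma_pos_pos[OF assms] by (simp add: C_iff flat_R)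
qed

subsection \<open>The Newton system\<close>

lemma flat_upd: "flat (upd x b u) = (\<lambda>a. if a = b then u else flat x a)"
  by (auto simp: flat_def upd_def fun_eq_iff prod_eq_iff)

context
  fixes x :: "nat \<Rightarrow> nat \<Rightarrow> real"
  assumes x: "ps.pos (flat x)"
begin

definition unit :: "nat \<times> nat \<Rightarrow> nat \<times> nat \<Rightarrow> real" where
  "unit b = (\<lambda>a. (if a = b then 1 else 0) / flat x a)"

lemma flat_upd_derivative:
  "((\<lambda>u. flat (upd x b u) a) has_real_derivative (if a = b then 1 else 0)) (at (flat x b))"
  unfolding flat_upd by (cases "a = b") auto

lemma flat_upd_at: "flat (upd x b (flat x b)) = flat x"
  unfolding flat_upd by (rule ext) simp

lemma DH_Some_Some:
  assumes a: "a \<in> idx"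
  shows "DH x lam (Some a) (Some b)
    = (if a = b then lam - ps.Ph a (flat x) else 0) - flat x a * ps.dPh a (flat x) (unit b)"
proof -
  have H: "(\<lambda>u. H (upd x b u) lam (Some a))
      = (\<lambda>u. - ps.Ph a (flat (upd x b u)) * flat (upd x b u) a + lam * flat (upd x b u) a)"
    by (cases a) (simp add: H_def r_def Phi_eq fun_eq_iff)
  have dPh: "((\<lambda>u. ps.Ph a (flat (upd x b u))) has_real_derivative ps.dPh a (flat x) (unit b)) (at (flat x b))"
    using ps.Ph_has_derivative[of "\<lambda>u. flat (upd x b u)", OF flat_upd_derivative _ a] x
    by (simp add: flat_upd_at unit_def)
  have der: "((\<lambda>u. - ps.Ph a (flat (upd x b u)) * flat (upd x b u) a + lam * flat (upd x b u) a) has_real_derivative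
     (- ps.dPh a (flat x) (unit b) * flat x a + (if a = b then 1 else 0) * - ps.Ph a (flat x))
      + lam * (if a = b then 1 else 0)) (at (flat x b))"
    using DERIV_add[OF DERIV_mult[OF DERIV_minus[OF dPh] flat_upd_derivative[of b a]]
        DERIV_cmult[OF flat_upd_derivative[of b a], of lam]]
    by (simp only: flat_upd_at)
  have "DH x lam (Some a) (Some b) = deriv (\<lambda>u. H (upd x b u) lam (Some a)) (flat x b)"
    by (cases b) (simp add: DH_def)
  then show ?thesis unfolding H DERIV_imp_deriv[OF der] by (simp add: mult.commute)
qed

lemma DH_Some_None: "DH x lam (Some a) None = flat x a"
proof -
  have "((\<lambda>u. H x u (Some a)) has_real_derivative flat x a) (at lam)"
    by (cases a) (auto simp: H_def r_def intro!: derivative_eq_intros)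
  then show ?thesis by (simp add: DH_def DERIV_imp_deriv)
qed

lemma DH_None_Some: "DH x lam None (Some b) = ps.cc (flat x) * ps.W (flat x) (unit b)"
proof -
  have "((\<lambda>u. ps.cc (flat (upd x b u))) has_real_derivative ps.cc (flat x) * ps.W (flat x) (unit b)) (at (flat x b))"
    using ps.cc_has_derivative[of "\<lambda>u. flat (upd x b u)", OF flat_upd_derivative] x
    by (simp add: flat_upd_at unit_def)
  then have "((\<lambda>u. H (upd x b u) lam None) has_real_derivative ps.cc (flat x) * ps.W (flat x) (unit b)) (at (flat x b))"
    by (auto simp: H_def c_eq intro!: derivative_eq_intros)
  then show ?thesis by (cases b) (simp add: DH_def DERIV_imp_deriv)
qed

lemma DH_None_None: "DH x lam None None = 0"
  by (simp add: DH_def H_def)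

lemma sum_idx1: "(\<Sum>b\<in>idx1. f b) = f None + (\<Sum>b\<in>idx. f (Some b))"
  unfolding idx1_def using finite_idx by (simp add: sum.reindex)

lemma sum_unit: "a \<in> idx \<Longrightarrow> (\<Sum>b\<in>idx. y b * unit b a) = y a / flat x a"
proof -
  assume a: "a \<in> idx"
  have "(\<Sum>b\<in>idx. y b * unit b a) = (\<Sum>b\<in>idx. if a = b then y b / flat x a else 0)"
    by (intro sum.cong) (auto simp: unit_def)
  then show ?thesis using a finite_idx by simp
qed

text \<open>
  A row of the Jacobian acts on \<open>y\<close> as the derivative of \<open>r\<close> in the direction of logarithmic velocity \<open>y / x\<close>.
\<close>

lemma DH_row_Some:
  assumes a: "a \<in> idx"
  shows "(\<Sum>b\<in>idx1. DH x lam (Some a) b * y b) = flat x a *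
    ((lam - ps.Ph a (flat x)) * (y (Some a) / flat x a) - ps.dPh a (flat x) (\<lambda>b. y (Some b) / flat x b) + y None)"
proof -
  have xa: "flat x a \<noteq> 0" using ps.posD[OF x a] by simp
  have "(\<Sum>b\<in>idx. ps.dPh a (flat x) (unit b) * y (Some b)) = ps.dPh a (flat x) (\<lambda>c. \<Sum>b\<in>idx. y (Some b) * unit b c)"
    unfolding ps.dPh_sum ps.dPh_cmult by (simp add: mult.commute)
  also have "\<dots> = ps.dPh a (flat x) (\<lambda>b. y (Some b) / flat x b)"
    using a sum_unit[of _ "\<lambda>b. y (Some b)"] by (intro ps.dPh_cong) auto
  finally have eq: "(\<Sum>b\<in>idx. ps.dPh a (flat x) (unit b) * y (Some b)) = ps.dPh a (flat x) (\<lambda>b. y (Some b) / flat x b)" .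
  have "(\<Sum>b\<in>idx. DH x lam (Some a) (Some b) * y (Some b))
      = (\<Sum>b\<in>idx. (if a = b then (lam - ps.Ph a (flat x)) * y (Some b) else 0)
          - flat x a * (ps.dPh a (flat x) (unit b) * y (Some b)))"
    by (intro sum.cong refl) (auto simp: DH_Some_Some[OF a] algebra_simps)
  also have "\<dots> = (lam - ps.Ph a (flat x)) * y (Some a) - flat x a * ps.dPh a (flat x) (\<lambda>b. y (Some b) / flat x b)"
    using a finite_idx by (simp add: sum_subtractf sum_distrib_left[symmetric] eq)
  finally have sum_Some: "(\<Sum>b\<in>idx. DH x lam (Some a) (Some b) * y (Some b))
      = (lam - ps.Ph a (flat x)) * y (Some a) - flat x a * ps.dPh a (flat x) (\<lambda>b. y (Some b) / flat x b)" .
  show ?thesis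
    unfolding sum_idx1 DH_Some_None sum_Some using xa by (simp add: algebra_simps)
qed

lemma DH_row_None:
  "(\<Sum>b\<in>idx1. DH x lam None b * y b) = ps.cc (flat x) * ps.W (flat x) (\<lambda>b. y (Some b) / flat x b)"
proof -
  have "(\<Sum>b\<in>idx. ps.W (flat x) (unit b) * y (Some b)) = (\<Sum>b\<in>idx. \<Sum>a\<in>idx. ps.w (flat x) a * (y (Some b) * unit b a))"
    unfolding ps.W_def sum_distrib_right by (intro sum.cong refl) (simp add: mult_ac)
  also have "\<dots> = (\<Sum>a\<in>idx. \<Sum>b\<in>idx. ps.w (flat x) a * (y (Some b) * unit b a))"
    by (rule sum.swap)
  also have "\<dots> = ps.W (flat x) (\<lambda>b. y (Some b) / flat x b)"
    unfolding ps.W_def using sum_unit[of _ "\<lambda>b. y (Some b)"]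
    by (intro sum.cong) (auto simp: sum_distrib_left[symmetric])
  finally show ?thesis
    unfolding sum_idx1 DH_None_None DH_None_Some by (simp add: sum_distrib_left[symmetric] mult.assoc)
qed

end

definition vel :: "(nat \<Rightarrow> nat \<Rightarrow> real) \<Rightarrow> (nat \<Rightarrow> nat \<Rightarrow> real) \<Rightarrow> nat \<times> nat \<Rightarrow> real" where
  "vel x dir a = flat dir a / flat x a"

lemma newton_step_newton:
  assumes x: "x \<in> C" and N: "newton_step x (phi x) dir del"
  shows "ps.newton (flat x) (vel x dir) del"
proof -
  define y where "y b = (case b of Some (k, l) \<Rightarrow> dir k l | None \<Rightarrow> del)" for b
  have pos: "ps.pos (flat x)" and c1: "ps.cc (flat x) = 1" using x by (simp_all add: C_iff)
  have y: "y (Some a) = flat dir a" "y None = del" for a by (cases a; simp add: y_def)+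
  have rows: "(\<Sum>b\<in>idx1. DH x (phi x) a b * y b) + H x (phi x) a = 0" if "a \<in> idx1" for a
    using N that unfolding newton_step_def y_def by blast
  have "ps.W (flat x) (vel x dir) = 0"
    using rows[of None] DH_row_None[OF pos, of "phi x" y] c1
    by (simp add: idx1_def H_def c_eq y vel_def[abs_def])
  moreover have "(ps.ph (flat x) - ps.Ph a (flat x)) * (vel x dir a + 1) + del = ps.dPh a (flat x) (vel x dir)"
    if a: "a \<in> idx" for a
  proof -
    have "H x (phi x) (Some a) = flat x a * (ps.ph (flat x) - ps.Ph a (flat x))"
      by (cases a) (simp add: H_def r_def Phi_eq phi_eq algebra_simps)
    then have "flat x a * ((ps.ph (flat x) - ps.Ph a (flat x)) * vel x dir a - ps.dPh a (flat x) (vel x dir) + del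
        + (ps.ph (flat x) - ps.Ph a (flat x))) = 0"
      using rows[of "Some a"] a DH_row_Some[OF pos a, of "phi x" y]
      by (simp add: idx1_def y vel_def[abs_def] phi_eq distrib_left)
    then have "(ps.ph (flat x) - ps.Ph a (flat x)) * vel x dir a - ps.dPh a (flat x) (vel x dir) + del
        + (ps.ph (flat x) - ps.Ph a (flat x)) = 0"
      using ps.posD[OF pos a] by (simp only: mult_eq_0_iff) simp
    then show ?thesis by (simp add: algebra_simps)
  qed
  ultimately show ?thesis by (simp add: ps.newton_def)
qed

lemma newton_step_exists:
  assumes x: "x \<in> C"
  shows "\<exists>dir del. newton_step x (phi x) dir del"
proof -
  have pos: "ps.pos (flat x)" and c1: "ps.cc (flat x) = 1" using x by (simp_all add: C_iff)
  have fin: "finite idx1" using finite_idx by (simp add: idx1_def)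
  have "\<exists>y. \<forall>a\<in>idx1. (\<Sum>b\<in>idx1. DH x (phi x) a b * y b) + H x (phi x) a = 0"
  proof (rule injective_square_system_solvable[OF fin])
    fix y assume rows: "\<And>a. a \<in> idx1 \<Longrightarrow> (\<Sum>b\<in>idx1. DH x (phi x) a b * y b) = 0"
    define v where "v = (\<lambda>b. y (Some b) / flat x b)"
    have "ps.W (flat x) v = 0"
      using rows[of None] DH_row_None[OF pos, of "phi x" y] c1 by (simp add: idx1_def v_def)
    moreover have "(ps.ph (flat x) - ps.Ph a (flat x)) * v a + y None = ps.dPh a (flat x) v" if a: "a \<in> idx" for a
      using rows[of "Some a"] a DH_row_Some[OF pos a, of "phi x" y] ps.posD[OF pos a]
      by (simp add: idx1_def v_def phi_eq)
    ultimately have "y None = 0 \<and> (\<forall>a\<in>idx. v a = 0)"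
      using ps.newton_matrix_injective[OF pos] by blast
    then show "\<forall>u\<in>idx1. y u = 0"
      using ps.posD[OF pos] by (force simp: idx1_def v_def)
  qed
  then obtain y where y: "\<forall>a\<in>idx1. (\<Sum>b\<in>idx1. DH x (phi x) a b * y b) + H x (phi x) a = 0" by blast
  define dir where "dir i j = (if (i, j) \<in> idx then y (Some (i, j)) else 0)" for i j
  have "(\<Sum>b\<in>idx1. DH x (phi x) a b * (case b of Some (k, l) \<Rightarrow> dir k l | None \<Rightarrow> y None))
      = (\<Sum>b\<in>idx1. DH x (phi x) a b * y b)" for a
    by (intro sum.cong refl) (auto simp: idx1_def dir_def)
  then have "newton_step x (phi x) dir (y None)"
    using y by (simp add: newton_step_def Rsigma_def dir_def)
  then show ?thesis by blast
qed

subsection \<open>Eigenpairs and runs\<close>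

lemma block_total:
  assumes i: "i \<in> {1..d}"
  shows "(\<Sum>t\<in>{1..n i}. x i t * scrA (s i) t (rep x))
    = (\<Sum>J\<in>multi_index m N. A J * (\<Prod>l\<in>{1..m}. rep x l (J l)))"
proof -
  have "x i t * scrA (s i) t (rep x)
      = (\<Sum>J | J \<in> multi_index m N \<and> J (s i) = t. A J * (\<Prod>l\<in>{1..m}. rep x l (J l)))" for t
    unfolding scrA_def sum_distrib_left
  proof (rule sum.cong[OF refl])
    fix J assume "J \<in> {J. J \<in> multi_index m N \<and> J (s i) = t}"
    then show "x i t * (A J * (\<Prod>l\<in>{1..m} - {s i}. rep x l (J l))) = A J * (\<Prod>l\<in>{1..m}. rep x l (J l))"
      using prod.remove[of "{1..m}" "s i" "\<lambda>l. rep x l (J l)"] s_in[OF i] block_of_s[OF i] by (simp add: rep_eq)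
  qed
  moreover have "(\<lambda>J. J (s i)) ` multi_index m N \<subseteq> {1..n i}"
    using s_in[OF i] by (auto simp: multi_index_def n_def)
  ultimately show ?thesis
    using sum.group[OF finite_multi_index, of "{1..n i}" "\<lambda>J. J (s i)"] by simp
qed

lemma positive_eigenpair_solution:
  assumes "positive_eigenpair lam x"
  shows "ps.solution (flat x) \<and> lam = ps.ph (flat x) \<and> x \<in> Rsigma"
proof -
  have x: "x \<in> Rsigma_pos" and eig: "eigenpair lam x"
    using assms by (simp_all add: positive_eigenpair_def)
  have pos: "ps.pos (flat x)" by (rule Rsigma_pos_pos[OF x])
  have Ph: "ps.Ph a (flat x) = lam" if a: "a \<in> idx" for a
  proof -
    obtain i j where ij: "a = (i, j)" by (cases a)
    have "0 < x i j" using ps.posD[OF pos a] ij by simp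
    moreover have "scrA (s i) j (rep x) = lam * psi (p i) (x i j)"
      using eig a ij by (simp add: eigenpair_def in_idx)
    ultimately show ?thesis using Phi_eq[of x i j] ij by (simp add: Phi_def psi_def)
  qed
  have "c x = 1" using eig by (simp add: c_def eigenpair_def)
  moreover have "(\<lambda>a. ps.Ph a (flat x)) ` idx = {lam}" using Ph ps.I_nonempty by force
  then have "ps.ph (flat x) = lam" by (simp add: ps.ph_def)
  ultimately show ?thesis
    using pos Ph x by (simp add: ps.solution_def c_eq Rsigma_pos_def)
qed

text \<open>
  Multiplying the equations of a block by its coordinates and summing gives the value of the
  tensor at \<open>x\<close>, whatever the block.  So \<open>\<parallel>x i\<parallel>\<close> to the power \<open>p i\<close> is the same for
  every block, and the normalisation of the product of the norms forces each norm to be \<open>1\<close>.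
\<close>

lemma solution_positive_eigenpair:
  assumes sol: "ps.solution (flat x)" and x: "x \<in> Rsigma"
  shows "positive_eigenpair (ps.ph (flat x)) x"
proof -
  define lam where "lam = ps.ph (flat x)"
  define \<tau> where "\<tau> = (\<Sum>J\<in>multi_index m N. A J * (\<Prod>l\<in>{1..m}. rep x l (J l))) / lam"
  have pos: "ps.pos (flat x)" and c1: "c x = 1" and Ph: "\<And>a. a \<in> idx \<Longrightarrow> ps.Ph a (flat x) = lam"
    using sol by (simp_all add: ps.solution_def c_eq lam_def)
  have lam: "0 < lam" unfolding lam_def by (rule ps.ph_pos[OF pos])
  have xpos: "0 < x i t" if "i \<in> {1..d}" "t \<in> {1..n i}" for i t
    using ps.posD[OF pos, of "(i, t)"] that by (simp add: in_idx)
  have eq: "scrA (s i) t (rep x) = lam * x i t powr (p i - 1)" if "i \<in> {1..d}" "t \<in> {1..n i}" for i t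
  proof -
    have "Phi x i t = lam" using Ph[of "(i, t)"] that by (simp add: Phi_eq in_idx)
    then show ?thesis using xpos[OF that] by (simp add: Phi_def field_simps)
  qed
  have psum: "(\<Sum>t\<in>{1..n i}. \<bar>x i t\<bar> powr p i) = \<tau>" if i: "i \<in> {1..d}" for i
  proof -
    have "lam * (\<Sum>t\<in>{1..n i}. \<bar>x i t\<bar> powr p i) = (\<Sum>t\<in>{1..n i}. x i t * scrA (s i) t (rep x))"
      unfolding sum_distrib_left
    proof (rule sum.cong[OF refl])
      fix t assume t: "t \<in> {1..n i}"
      show "lam * \<bar>x i t\<bar> powr p i = x i t * scrA (s i) t (rep x)"
        using xpos[OF i t] eq[OF i t] powr_diff[of "x i t" "p i" 1] by simp
    qed
    then show ?thesis unfolding block_total[OF i] \<tau>_def using lam by (simp add: field_simps)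
  qed
  have norm: "lp_norm (n i) (p i) (x i) = \<tau> powr (1 / p i)" if "i \<in> {1..d}" for i
    using psum[OF that] by (simp add: lp_norm_def)
  have d1: "1 \<in> {1..d}" using d_ge_1 by simp
  have "0 < (\<Sum>t\<in>{1..n 1}. \<bar>x 1 t\<bar> powr p 1)"
    using xpos[OF d1] n_ge_1[OF d1] by (intro sum_pos) force+
  then have \<tau>: "0 < \<tau>" using psum[OF d1] by simp
  have "\<tau> powr (\<Sum>i\<in>{1..d}. 1 / p i) = (\<Prod>i\<in>{1..d}. \<tau> powr (1 / p i))"
    using \<tau> by (intro powr_sum) auto
  also have "\<dots> = 1" using c1 norm by (simp add: c_def)
  finally have "(\<Sum>i\<in>{1..d}. 1 / p i) * ln \<tau> = 0"
    using \<tau> by (simp add: powr_def)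
  moreover have "0 < (\<Sum>i\<in>{1..d}. 1 / p i)"
    using p_gt_1 d_ge_1 by (intro sum_pos) force+
  ultimately have "\<tau> = 1" using \<tau> by simp
  then have "lp_norm (n i) (p i) (x i) = 1" if "i \<in> {1..d}" for i
    using norm[OF that] by simp
  moreover have "psi (p i) (x i t) = x i t powr (p i - 1)" if "i \<in> {1..d}" "t \<in> {1..n i}" for i t
    using xpos[OF that] by (simp add: psi_def)
  ultimately have "eigenpair lam x"
    unfolding eigenpair_def using x eq by simp
  moreover have "x \<in> Rsigma_pos"
    using x ps.posD[OF pos] by (force simp: Rsigma_pos_def)
  ultimately show ?thesis using lam by (simp add: positive_eigenpair_def lam_def)
qed

lemma flat_move: "a \<in> idx \<Longrightarrow> x \<in> C \<Longrightarrow> flat (move x al dir) a = ps.along (flat x) (vel x dir) al a"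
  using ps.posD[of "flat x" a] by (simp add: flat_def move_def ps.along_def vel_def C_iff algebra_simps)

lemma rn_move:
  assumes "a \<in> idx" "x \<in> C"
  shows "flat (R (move x al dir)) a = ps.rn (ps.along (flat x) (vel x dir) al) a"
  using flat_move[OF _ assms(2), of _ al dir] assms(1)
    ps.cc_cong[of "flat (move x al dir)" "ps.along (flat x) (vel x dir) al"]
  by (simp add: flat_R ps.rn_def)

lemma admissible_iff:
  assumes x: "x \<in> C" and dir: "dir \<in> Rsigma"
  shows "al \<in> admissible_steps sg rho x dir del
    \<longleftrightarrow> (\<exists>i. al = rho ^ i) \<and> ps.adm sg (flat x) (vel x dir) del al"
proof -
  have "move x al dir \<in> Rsigma"
    using x dir by (simp add: C_iff Rsigma_def move_def)
  then have "move x al dir \<in> Rsigma_pos \<longleftrightarrow> ps.pos (flat (move x al dir))"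
    by (auto simp: Rsigma_pos_def ps.pos_def)
  also have "\<dots> \<longleftrightarrow> ps.pos (ps.along (flat x) (vel x dir) al)"
    using flat_move[OF _ x] by (intro ps.pos_cong)
  finally have pos: "move x al dir \<in> Rsigma_pos \<longleftrightarrow> ps.pos (ps.along (flat x) (vel x dir) al)" .
  have "phi (R (move x al dir)) = ps.ph (ps.rn (ps.along (flat x) (vel x dir) al))"
    unfolding phi_eq using rn_move[OF _ x] by (intro ps.ph_cong)
  with pos show ?thesis
    unfolding admissible_steps_def ps.adm_def phi_eq[of x] by auto
qed

lemma H_zero_iff:
  assumes x: "x \<in> C"
  shows "(\<forall>a\<in>idx1. H x (phi x) a = 0) \<longleftrightarrow> (\<forall>a\<in>idx. ps.Ph a (flat x) = ps.ph (flat x))"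
proof -
  have "H x (phi x) (Some a) = flat x a * (ps.ph (flat x) - ps.Ph a (flat x))" for a
    by (cases a) (simp add: H_def r_def Phi_eq phi_eq algebra_simps)
  moreover have "H x (phi x) None = 0" using x by (simp add: H_def C_def)
  moreover have "flat x a \<noteq> 0" if "a \<in> idx" for a using ps.posD[of "flat x", OF _ that] x by (simp add: C_iff)
  ultimately show ?thesis by (auto simp: idx1_def)
qed

text \<open>
  The constant continuation after termination is also a run of the damped Newton iteration: the
  zero step solves the Newton system there and the step length \<open>1\<close> is admissible.
\<close>

lemma LS_NNM_run:
  assumes u0: "u0 \<in> C" and rho: "0 < rho" "rho < 1" and LS: "LS_NNM sg rho u0 x lam dir del al"
  shows "ps.run sg rho (\<lambda>k. flat (x k)) (\<lambda>k. vel (x k) (dir k)) del al" "\<And>k. x k \<in> C \<and> lam k = phi (x k)"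
proof -
  have init: "x 0 = R u0" "lam 0 = phi (x 0)"
    and step: "\<And>k. if \<forall>a\<in>idx1. H (x k) (lam k) a = 0
          then x (Suc k) = x k \<and> lam (Suc k) = lam k \<and>
               dir k = (\<lambda>_ _. 0) \<and> del k = 0 \<and> al k = 1
          else newton_step (x k) (lam k) (dir k) (del k) \<and>
               al k \<in> admissible_steps sg rho (x k) (dir k) (del k) \<and>
               (\<forall>\<beta>\<in>admissible_steps sg rho (x k) (dir k) (del k). \<beta> \<le> al k) \<and>
               x (Suc k) = R (move (x k) (al k) (dir k)) \<and>
               lam (Suc k) = phi (x (Suc k))"
    using LS unfolding LS_NNM_def by blast+
  have inv: "x k \<in> C \<and> lam k = phi (x k)" for k
  proof (induction k)
    case 0
    show ?case using init R_in_C[of u0] u0 by (simp add: C_def)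
  next
    case (Suc k)
    show ?case
    proof (cases "\<forall>a\<in>idx1. H (x k) (lam k) a = 0")
      case True
      then have "x (Suc k) = x k \<and> lam (Suc k) = lam k" using step[of k] by argo
      then show ?thesis using Suc by simp
    next
      case False
      then have "al k \<in> admissible_steps sg rho (x k) (dir k) (del k)"
        "x (Suc k) = R (move (x k) (al k) (dir k))" "lam (Suc k) = phi (x (Suc k))"
        using step[of k] by argo+
      then show ?thesis using R_in_C by (simp add: admissible_steps_def)
    qed
  qed
  show "x k \<in> C \<and> lam k = phi (x k)" for k by (rule inv)
  show "ps.run sg rho (\<lambda>k. flat (x k)) (\<lambda>k. vel (x k) (dir k)) del al"
    unfolding ps.run_def
  proof (intro conjI allI)
    show "ps.pos (flat (x 0))" "ps.cc (flat (x 0)) = 1" using inv[of 0] by (simp_all add: C_iff)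
    fix k
    have xC: "x k \<in> C" and lam: "lam k = phi (x k)" using inv[of k] by simp_all
    have "ps.newton (flat (x k)) (vel (x k) (dir k)) (del k) \<and> (\<exists>i. al k = rho ^ i) \<and>
      ps.adm sg (flat (x k)) (vel (x k) (dir k)) (del k) (al k) \<and>
      (\<forall>i. ps.adm sg (flat (x k)) (vel (x k) (dir k)) (del k) (rho ^ i) \<longrightarrow> rho ^ i \<le> al k) \<and>
      (\<forall>b\<in>idx. flat (x (Suc k)) b = ps.rn (ps.along (flat (x k)) (vel (x k) (dir k)) (al k)) b)"
    proof (cases "\<forall>a\<in>idx1. H (x k) (lam k) a = 0")
      case True
      then have k: "x (Suc k) = x k" "dir k = (\<lambda>_ _. 0)" "del k = 0" "al k = 1" using step[of k] by argo+
      have Ph: "\<forall>a\<in>idx. ps.Ph a (flat (x k)) = ps.ph (flat (x k))"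
        using True H_zero_iff[OF xC] by (simp only: lam)
      have v0: "vel (x k) (\<lambda>_ _. 0) = (\<lambda>_. 0)" by (simp add: vel_def[abs_def] flat_def)
      have al0: "ps.along (flat (x k)) (\<lambda>_. 0) t = flat (x k)" for t by (simp add: ps.along_def)
      have rn: "ps.rn (flat (x k)) = flat (x k)" using xC by (intro ps.rn_id) (simp add: C_iff)
      have "ps.newton (flat (x k)) (\<lambda>_. 0) 0"
        using Ph by (simp add: ps.newton_def ps.W_def ps.dPh_0)
      moreover have "\<exists>i. 1 = rho ^ i" by (rule exI[of _ 0]) simp
      moreover have "rho ^ i \<le> 1" for i using rho by (intro power_le_one) auto
      ultimately show ?thesis
        using xC unfolding k v0 ps.adm_def al0 rn C_iff by auto
    next
      case False
      then have k: "newton_step (x k) (lam k) (dir k) (del k)"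
        "al k \<in> admissible_steps sg rho (x k) (dir k) (del k)"
        "\<forall>\<beta>\<in>admissible_steps sg rho (x k) (dir k) (del k). \<beta> \<le> al k"
        "x (Suc k) = R (move (x k) (al k) (dir k))"
        using step[of k] by argo+
      have dir: "dir k \<in> Rsigma" using k(1) by (simp add: newton_step_def)
      have "ps.newton (flat (x k)) (vel (x k) (dir k)) (del k)"
        using newton_step_newton[OF xC] k(1) lam by simp
      moreover have "rho ^ i \<le> al k" if "ps.adm sg (flat (x k)) (vel (x k) (dir k)) (del k) (rho ^ i)" for i
        using that k(3) admissible_iff[OF xC dir] by blast
      moreover have "(\<exists>i. al k = rho ^ i) \<and> ps.adm sg (flat (x k)) (vel (x k) (dir k)) (del k) (al k)"
        using k(2) admissible_iff[OF xC dir] by blast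
      moreover have "\<forall>b\<in>idx. flat (x (Suc k)) b = ps.rn (ps.along (flat (x k)) (vel (x k) (dir k)) (al k)) b"
        unfolding k(4) using rn_move[OF _ xC] by blast
      ultimately show ?thesis by blast
    qed
    then show "ps.newton (flat (x k)) (vel (x k) (dir k)) (del k)" "\<exists>i. al k = rho ^ i"
      "ps.adm sg (flat (x k)) (vel (x k) (dir k)) (del k) (al k)"
      "\<And>i. ps.adm sg (flat (x k)) (vel (x k) (dir k)) (del k) (rho ^ i) \<longrightarrow> rho ^ i \<le> al k"
      "\<forall>b\<in>idx. flat (x (Suc k)) b = ps.rn (ps.along (flat (x k)) (vel (x k) (dir k)) (al k)) b"
      by blast+
  qed
qed

text \<open>
  The Newton equation has a solution because the Newton matrix is injective, the slope is negative before
  termination, and a negative slope makes the line search succeed; so each state has a successor, and choosing one at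
  each point gives a run.
\<close>

lemma LS_NNM_exists:
  assumes sg: "sg < 1" and rho: "0 < rho" "rho < 1" and u0: "u0 \<in> C"
  shows "\<exists>x lam dir del al. LS_NNM sg rho u0 x lam dir del al"
proof -
  define good where "good x dir del al y \<longleftrightarrow> y \<in> C \<and>
    (if \<forall>a\<in>idx1. H x (phi x) a = 0
     then y = x \<and> dir = (\<lambda>_ _. 0) \<and> del = 0 \<and> al = 1
     else newton_step x (phi x) dir del \<and> al \<in> admissible_steps sg rho x dir del \<and>
          (\<forall>\<beta>\<in>admissible_steps sg rho x dir del. \<beta> \<le> al) \<and> y = R (move x al dir))"
    for x dir del al y
  have ex: "\<exists>dir del al y. good x dir del al y" if x: "x \<in> C" for x
  proof (cases "\<forall>a\<in>idx1. H x (phi x) a = 0")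
    case True
    then show ?thesis using x unfolding good_def by (intro exI conjI) auto
  next
    case False
    obtain dir del where N: "newton_step x (phi x) dir del" using newton_step_exists[OF x] by blast
    have N': "ps.newton (flat x) (vel x dir) del" by (rule newton_step_newton[OF x N])
    have pos: "ps.pos (flat x)" "ps.cc (flat x) = 1" using x by (simp_all add: C_iff)
    have dir: "dir \<in> Rsigma" using N by (simp add: newton_step_def)
    have "\<not> 0 \<le> del"
      using ps.newton_decrease_nonneg[OF pos(1) N'] False H_zero_iff[OF x] by blast
    then have "del < 0" by simp
    from ps.step_exists[OF sg rho pos N' this] obtain i where
      i: "ps.adm sg (flat x) (vel x dir) del (rho ^ i)"
        "\<And>j. ps.adm sg (flat x) (vel x dir) del (rho ^ j) \<Longrightarrow> rho ^ j \<le> rho ^ i" by blast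
    have adm: "rho ^ i \<in> admissible_steps sg rho x dir del"
      using i(1) unfolding admissible_iff[OF x dir] by blast
    have "\<forall>\<beta>\<in>admissible_steps sg rho x dir del. \<beta> \<le> rho ^ i"
    proof
      fix \<beta> assume "\<beta> \<in> admissible_steps sg rho x dir del"
      then obtain j where "\<beta> = rho ^ j" "ps.adm sg (flat x) (vel x dir) del (rho ^ j)"
        unfolding admissible_iff[OF x dir] by blast
      then show "\<beta> \<le> rho ^ i" using i(2) by simp
    qed
    moreover have "R (move x (rho ^ i) dir) \<in> C"
      using adm by (intro R_in_C) (simp add: admissible_steps_def)
    ultimately have "good x dir del (rho ^ i) (R (move x (rho ^ i) dir))"
      using N adm unfolding good_def if_not_P[OF False] by blast
    then show ?thesis by blast
  qed
  then have "\<forall>x\<in>C. \<exists>w. good x (fst w) (fst (snd w)) (fst (snd (snd w))) (snd (snd (snd w)))" by force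
  from bchoice[OF this] obtain w where
    w: "\<And>x. x \<in> C \<Longrightarrow> good x (fst (w x)) (fst (snd (w x))) (fst (snd (snd (w x)))) (snd (snd (snd (w x))))"
    by blast
  define x where "x = rec_nat (R u0) (\<lambda>_ y. snd (snd (snd (w y))))"
  have x0: "x 0 = R u0" and xS: "x (Suc k) = snd (snd (snd (w (x k))))" for k by (simp_all add: x_def)
  have xC: "x k \<in> C" for k
  proof (induction k)
    case 0
    show ?case using R_in_C[of u0] u0 by (simp add: x0 C_def)
  next
    case (Suc k)
    then show ?case using w[OF Suc] unfolding xS good_def by blast
  qed
  have "LS_NNM sg rho u0 x (\<lambda>k. phi (x k)) (\<lambda>k. fst (w (x k))) (\<lambda>k. fst (snd (w (x k))))
    (\<lambda>k. fst (snd (snd (w (x k)))))"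
    unfolding LS_NNM_def
  proof (intro conjI allI)
    show "x 0 = R u0" by (rule x0)
    show "phi (x 0) = phi (x 0)" ..
    fix k
    show "if \<forall>a\<in>idx1. H (x k) (phi (x k)) a = 0
          then x (Suc k) = x k \<and> phi (x (Suc k)) = phi (x k) \<and>
               fst (w (x k)) = (\<lambda>_ _. 0) \<and> fst (snd (w (x k))) = 0 \<and> fst (snd (snd (w (x k)))) = 1
          else newton_step (x k) (phi (x k)) (fst (w (x k))) (fst (snd (w (x k)))) \<and>
               fst (snd (snd (w (x k)))) \<in> admissible_steps sg rho (x k) (fst (w (x k))) (fst (snd (w (x k)))) \<and>
               (\<forall>\<beta>\<in>admissible_steps sg rho (x k) (fst (w (x k))) (fst (snd (w (x k)))). \<beta> \<le> fst (snd (snd (w (x k))))) \<and>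
               x (Suc k) = R (move (x k) (fst (snd (snd (w (x k))))) (fst (w (x k)))) \<and>
               phi (x (Suc k)) = phi (x (Suc k))"
      using w[OF xC[of k]] unfolding good_def xS[symmetric] by (simp split: if_split_asm)
  qed
  then show ?thesis by blast
qed

lemma LS_NNM_converges_to_eigenpair:
  assumes sg: "0 < sg" "sg < 1" and rho: "0 < rho" "rho < 1" and u0: "u0 \<in> C"
    and LS: "LS_NNM sg rho u0 x lam dir del al"
  shows "\<exists>lam' x'. positive_eigenpair lam' x' \<and> lam \<longlonglongrightarrow> lam' \<and> (\<forall>(i, j)\<in>idx. (\<lambda>k. x k i j) \<longlonglongrightarrow> x' i j)"
proof -
  note run = LS_NNM_run(1)[OF u0 rho LS]
  from ps.run_converges[OF sg rho run] obtain y where y: "ps.solution y"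
    and lim: "\<And>a. a \<in> idx \<Longrightarrow> (\<lambda>k. flat (x k) a) \<longlonglongrightarrow> y a"
    and phi: "(\<lambda>k. ps.ph (flat (x k))) \<longlonglongrightarrow> ps.ph y" by blast
  define x' where "x' i j = (if (i, j) \<in> idx then y (i, j) else 0)" for i j
  have x'y: "flat x' a = y a" if "a \<in> idx" for a using that by (cases a) (simp add: x'_def)
  have "ps.solution (flat x')"
    using y ps.pos_cong[of "flat x'" y] ps.cc_cong[of "flat x'" y] ps.ph_cong[of "flat x'" y]
      ps.Ph_cong[of "flat x'" y] x'y by (simp add: ps.solution_def)
  moreover have "x' \<in> Rsigma" by (simp add: Rsigma_def x'_def)
  ultimately have "positive_eigenpair (ps.ph (flat x')) x'" by (rule solution_positive_eigenpair)
  moreover have "lam \<longlonglongrightarrow> ps.ph (flat x')"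
  proof -
    have "lam = (\<lambda>k. ps.ph (flat (x k)))"
      using LS_NNM_run(2)[OF u0 rho LS] by (simp add: fun_eq_iff phi_eq)
    then show ?thesis using phi ps.ph_cong[of "flat x'" y] x'y by simp
  qed
  moreover have "\<forall>(i, j)\<in>idx. (\<lambda>k. x k i j) \<longlonglongrightarrow> x' i j"
    using lim by (force simp: x'_def)
  ultimately show ?thesis by blast
qed

lemma positive_eigenpair_unique:
  assumes "positive_eigenpair lam x" "positive_eigenpair mu y"
  shows "mu = lam \<and> y = x"
proof -
  note x = positive_eigenpair_solution[OF assms(1)] and y = positive_eigenpair_solution[OF assms(2)]
  have eq: "flat y a = flat x a" if "a \<in> idx" for a
    using ps.solution_unique x y that by blast
  have "y i j = x i j" for i j
  proof (cases "(i, j) \<in> idx")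
    case True
    then show ?thesis using eq[OF True] by simp
  next
    case False
    then show ?thesis using x y by (simp add: Rsigma_def)
  qed
  then have "y = x" by (simp add: fun_eq_iff)
  then show ?thesis using x y by simp
qed

end

section \<open>Convergence of LS-NNM\<close>

theorem theorem4p5:
  fixes m :: nat and N :: "nat \<Rightarrow> nat" and A :: "(nat \<Rightarrow> nat) \<Rightarrow> real"
    and d :: nat and \<sigma> :: "nat \<Rightarrow> nat set" and p :: "nat \<Rightarrow> real"
    and sg rho :: real and u0 :: "nat \<Rightarrow> nat \<Rightarrow> real"
  assumes "nonneg_tensor m N A"
    and "shape_partition m N d \<sigma>"
    and "\<forall>i\<in>{1..d}. 1 < p i"
    and "tensor_data.strictly_nonnegative m N A d \<sigma> \<and> (\<Sum>i\<in>{1..d}. real (card (\<sigma> i)) / p i) < 1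
       \<or> tensor_data.weakly_irreducible m N A d \<sigma> \<and> (\<Sum>i\<in>{1..d}. real (card (\<sigma> i)) / p i) = 1"
    and "0 < sg" "sg < 1" "0 < rho" "rho < 1"
    and "u0 \<in> tensor_data.C N d \<sigma> p"
  shows "\<exists>lam' x'.
      tensor_data.positive_eigenpair m N A d \<sigma> p lam' x' \<and>
      (\<forall>mu y. tensor_data.positive_eigenpair m N A d \<sigma> p mu y \<longrightarrow> mu = lam' \<and> y = x') \<and>
      (\<exists>x lam dir del al. tensor_data.LS_NNM m N A d \<sigma> p sg rho u0 x lam dir del al) \<and>
      (\<forall>x lam dir del al. tensor_data.LS_NNM m N A d \<sigma> p sg rho u0 x lam dir del al \<longrightarrow>
         lam \<longlonglongrightarrow> lam' \<and>
         (\<forall>(i, j)\<in>tensor_data.idx N d \<sigma>. (\<lambda>k. x k i j) \<longlonglongrightarrow> x' i j))"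
proof -
  interpret ls_nnm_data m N A d \<sigma> p
    using assms(1-4) by unfold_locales blast+
  have ex: "\<exists>x lam dir del al. LS_NNM sg rho u0 x lam dir del al"
    using assms by (intro LS_NNM_exists) auto
  have conv: "\<exists>lam' x'. positive_eigenpair lam' x' \<and> lam \<longlonglongrightarrow> lam' \<and> (\<forall>(i, j)\<in>idx. (\<lambda>k. x k i j) \<longlonglongrightarrow> x' i j)"
    if "LS_NNM sg rho u0 x lam dir del al" for x lam dir del al
    using assms that by (intro LS_NNM_converges_to_eigenpair) auto
  from ex conv obtain lam' x' where pair: "positive_eigenpair lam' x'" by blast
  show ?thesis
  proof (intro exI[of _ lam'] exI[of _ x'] conjI allI impI pair ex)
    fix mu y assume "positive_eigenpair mu y"
    from positive_eigenpair_unique[OF pair this] show "mu = lam'" "y = x'" by simp_all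
  next
    fix x lam dir del al assume "LS_NNM sg rho u0 x lam dir del al"
    from conv[OF this] obtain lam1 x1 where pair1: "positive_eigenpair lam1 x1"
      and lims: "lam \<longlonglongrightarrow> lam1" "\<forall>(i, j)\<in>idx. (\<lambda>k. x k i j) \<longlonglongrightarrow> x1 i j" by blast
    from positive_eigenpair_unique[OF pair pair1] lims
    show "lam \<longlonglongrightarrow> lam'" "\<forall>(i, j)\<in>idx. (\<lambda>k. x k i j) \<longlonglongrightarrow> x' i j" by simp_all
  qed
qed

end
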